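(* Let $A$ be an algebra over an infinite field such that every commutator in $A$ is a sum of nilpotent elements, and such that every proper ideal of $A$ is contained in a non-exceptional prime ideal. Let $V\subseteq A$ be a fully noncentral subspace. Then the following are equivalent: (1) $V$ is invariant under all inner automorphisms of $A$. (2) $V$ is invariant under all inner automorphisms induced by nilpotent elements of $A$, that is, $(1+x+x^2+\cdots+x^{k-1})a(1-x)\in V$ for all $a\in V$ and all $x\in A$, $k\geq 1$ with $x^k=0$. (3) $[A,A]\subseteq V$. (4) $V$ is a Lie ideal in $A$. (5) $V$ is an $[A,A]$-submodule.
   Context: Rings and algebras are associative and not necessarily unital; ideals are two-sided. $[x,y]=xy-yx$. For subsets $G,H$ of a ring $A$, at least one of which is an additive subgroup, $[G,H]$ is the additive subgroup generated by all $[g,h]$ with $g\in G$, $h\in H$. A subset of $A$ is full if it is not contained in a proper ideal of $A$. A subset $X\subseteq A$ is fully noncentral if $[A,X]$ is full. An additive subgroup $V$ is a Lie ideal if $[A,V]\subseteq V$, and it is an $[A,A]$-submodule if $[[A,A],V]\subseteq V$. The minimal unitization $\widetilde{A}$ is $A$ if $A$ is unital, and otherwise $\mathbb{Z}\times A$ with coordinatewise addition and multiplication $(m,x)(n,y)=(mn,my+nx+xy)$, in which $A$ is an ideal via $x\mapsto(0,x)$. An automorphism of $A$ is inner if it has the form $a\mapsto vav^{-1}$ for some invertible $v\in\widetilde{A}$. A subset $V$ is invariant under $\alpha$ if $\alpha(V)\subseteq V$. Prime ideals are proper, and an ideal $P$ is prime if and only if $A/P$ is a (nonzero) prime ring. A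 prime ring $S$ is exceptional if it has characteristic $2$ (i.e. $2x=0$ for all $x\in S$) and satisfies the polynomial identity $s_4$, where $s_4(x_1,\ldots,x_4)=\sum_{\sigma\in S_4}\mathrm{sign}(\sigma)x_{\sigma(1)}x_{\sigma(2)}x_{\sigma(3)}x_{\sigma(4)}$. A prime ideal $P$ of $A$ is exceptional if the prime ring $A/P$ is exceptional; otherwise it is non-exceptional. *)

theory Defs
  imports Complex_Main
    "HOL-Algebra.QuotRing"
    "HOL-Combinatorics.Permutations"
    "HOL-Computational_Algebra.Group_Closure"
begin

text \<open>
  The type class \<^class>\<open>ring\<close> does not require a unit, so a type of this class is an associative,
  not necessarily unital ring \<open>A\<close>.
\<close>

locale rng_algebra = vector_space scale
  for scale :: "'k::field \<Rightarrow> 'a::ring \<Rightarrow> 'a" +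
  assumes scale_mult_left: "scale c x * y = scale c (x * y)"
    and scale_mult_right: "x * scale c y = scale c (x * y)"

definition additive_subgroup_of :: "'a::ring set \<Rightarrow> bool" where
  "additive_subgroup_of V \<longleftrightarrow> 0 \<in> V \<and> (\<forall>x\<in>V. \<forall>y\<in>V. x - y \<in> V)"

definition two_sided_ideal :: "'a::ring set \<Rightarrow> bool" where
  "two_sided_ideal I \<longleftrightarrow>
     additive_subgroup_of I \<and> (\<forall>a. \<forall>x\<in>I. a * x \<in> I \<and> x * a \<in> I)"

definition commutator :: "'a::ring \<Rightarrow> 'a \<Rightarrow> 'a" where
  "commutator x y = x * y - y * x"

definition commutator_span :: "'a::ring set \<Rightarrow> 'a set \<Rightarrow> 'a set" where
  "commutator_span G H = group_closure {commutator g h | g h. g \<in> G \<and> h \<in> H}"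

definition full :: "'a::ring set \<Rightarrow> bool" where
  "full X \<longleftrightarrow> \<not> (\<exists>I. two_sided_ideal I \<and> I \<noteq> UNIV \<and> X \<subseteq> I)"

definition fully_noncentral :: "'a::ring set \<Rightarrow> bool" where
  "fully_noncentral X \<longleftrightarrow> full (commutator_span UNIV X)"

definition lie_ideal :: "'a::ring set \<Rightarrow> bool" where
  "lie_ideal V \<longleftrightarrow> additive_subgroup_of V \<and> commutator_span UNIV V \<subseteq> V"

definition derived_submodule :: "'a::ring set \<Rightarrow> bool" where
  "derived_submodule V \<longleftrightarrow>
     additive_subgroup_of V \<and> commutator_span (commutator_span UNIV UNIV) V \<subseteq> V"


section \<open>Exceptional prime ideals\<close>

definition prime_ideal :: "'a::ring set \<Rightarrow> bool" where
  "prime_ideal P \<longleftrightarrow> two_sided_ideal P \<and> P \<noteq> UNIV \<and>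
     (\<forall>I J. two_sided_ideal I \<longrightarrow> two_sided_ideal J \<longrightarrow>
        (\<forall>x\<in>I. \<forall>y\<in>J. x * y \<in> P) \<longrightarrow> I \<subseteq> P \<or> J \<subseteq> P)"

text \<open>
  \<open>A\<close> as a record, in order to form the quotient \<open>A/P\<close>. The field \<^const>\<open>one\<close> is a
  dummy that none of the definitions below uses.
\<close>

definition rng_of :: "'a::ring ring" where
  "rng_of = \<lparr>carrier = UNIV, monoid.mult = (*), one = undefined, zero = 0, add = (+)\<rparr>"

definition satisfies_s4 :: "('b, 'm) ring_scheme \<Rightarrow> bool" where
  "satisfies_s4 S \<longleftrightarrow> (\<forall>x \<in> {1..4::nat} \<rightarrow> carrier S.
     (\<Oplus>\<^bsub>S\<^esub> \<sigma> \<in> {\<sigma>. \<sigma> permutes {1..4}}.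
        [sign \<sigma>] \<cdot>\<^bsub>S\<^esub> (x (\<sigma> 1) \<otimes>\<^bsub>S\<^esub> x (\<sigma> 2) \<otimes>\<^bsub>S\<^esub> x (\<sigma> 3) \<otimes>\<^bsub>S\<^esub> x (\<sigma> 4))) = \<zero>\<^bsub>S\<^esub>)"

text \<open>To be applied to prime rings only.\<close>

definition exceptional_ring :: "('b, 'm) ring_scheme \<Rightarrow> bool" where
  "exceptional_ring S \<longleftrightarrow> (\<forall>x\<in>carrier S. x \<oplus>\<^bsub>S\<^esub> x = \<zero>\<^bsub>S\<^esub>) \<and> satisfies_s4 S"

definition exceptional_prime_ideal :: "'a::ring set \<Rightarrow> bool" where
  "exceptional_prime_ideal P \<longleftrightarrow> prime_ideal P \<and> exceptional_ring (rng_of Quot P)"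

definition nonexceptional_prime_ideal :: "'a::ring set \<Rightarrow> bool" where
  "nonexceptional_prime_ideal P \<longleftrightarrow> prime_ideal P \<and> \<not> exceptional_prime_ideal P"


section \<open>The minimal unitization and inner automorphisms\<close>

definition is_unit_element :: "'a::ring \<Rightarrow> bool" where
  "is_unit_element e \<longleftrightarrow> (\<forall>x. e * x = x \<and> x * e = x)"

text \<open>
  If \<open>A\<close> is unital, the minimal unitization is \<open>A\<close> itself, here in the form of the ring
  \<open>{0} \<times> A\<close>; otherwise it is \<open>\<int> \<times> A\<close>. In both cases \<open>A\<close> is embedded by \<open>x \<mapsto> (0, x)\<close>.
\<close>

definition unitization :: "(int \<times> 'a::ring) ring" where
  "unitization =
     \<lparr>carrier = (if \<exists>e::'a. is_unit_element e then {0} \<times> UNIV else UNIV),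
      monoid.mult = (\<lambda>(m, x) (n, y). (m * n, [m] \<cdot>\<^bsub>rng_of\<^esub> y + [n] \<cdot>\<^bsub>rng_of\<^esub> x + x * y)),
      one = (if \<exists>e::'a. is_unit_element e then (0, THE e. is_unit_element e) else (1, 0)),
      zero = (0, 0),
      add = (\<lambda>(m, x) (n, y). (m + n, x + y))\<rparr>"

definition to_unitization :: "'a::ring \<Rightarrow> int \<times> 'a" where
  "to_unitization x = (0, x)"

definition inner_automorphism :: "('a::ring \<Rightarrow> 'a) \<Rightarrow> bool" where
  "inner_automorphism \<alpha> \<longleftrightarrow> (\<exists>v \<in> Units unitization. \<forall>a.
     to_unitization (\<alpha> a) = v \<otimes>\<^bsub>unitization\<^esub> to_unitization a \<otimes>\<^bsub>unitization\<^esub> inv\<^bsub>unitization\<^esub> v)"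

definition invariant_under :: "'a set \<Rightarrow> ('a \<Rightarrow> 'a) \<Rightarrow> bool" where
  "invariant_under V \<alpha> \<longleftrightarrow> \<alpha> ` V \<subseteq> V"

text \<open>
  A ring without unit has no zeroth power, so powers of \<open>x\<close> are taken in the unitization;
  for \<open>k \<ge> 1\<close> they are the powers formed in \<open>A\<close>.
\<close>

definition power_vanishes :: "'a::ring \<Rightarrow> nat \<Rightarrow> bool" where
  "power_vanishes x k \<longleftrightarrow> to_unitization x [^]\<^bsub>unitization\<^esub> k = \<zero>\<^bsub>unitization\<^esub>"

definition nilpotent :: "'a::ring \<Rightarrow> bool" where
  "nilpotent x \<longleftrightarrow> (\<exists>k\<ge>1. power_vanishes x k)"

definition sum_of_nilpotents :: "'a::ring \<Rightarrow> bool" where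
  "sum_of_nilpotents x \<longleftrightarrow> (\<exists>ys. (\<forall>y\<in>set ys. nilpotent y) \<and> x = sum_list ys)"

definition nilpotent_conjugate :: "'a::ring \<Rightarrow> nat \<Rightarrow> 'a \<Rightarrow> int \<times> 'a" where
  "nilpotent_conjugate x k a =
     (\<Oplus>\<^bsub>unitization\<^esub> i \<in> {..<k}. to_unitization x [^]\<^bsub>unitization\<^esub> i)
       \<otimes>\<^bsub>unitization\<^esub> to_unitization a
       \<otimes>\<^bsub>unitization\<^esub> (\<one>\<^bsub>unitization\<^esub> \<ominus>\<^bsub>unitization\<^esub> to_unitization x)"


text \<open>
  Sanity checks: the addition of \<^const>\<open>rng_of\<close> makes it an abelian group, and
  \<^const>\<open>unitization\<close> is a ring with unit.
\<close>

lemma abelian_group_rng_of: "abelian_group (rng_of :: 'a::ring ring)"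
proof (rule abelian_groupI)
  fix x :: 'a
  show "\<exists>y\<in>carrier rng_of. y \<oplus>\<^bsub>rng_of\<^esub> x = \<zero>\<^bsub>rng_of\<^esub>"
    by (rule bexI[of _ "- x"]) (auto simp: rng_of_def)
qed (auto simp: rng_of_def algebra_simps)

lemma is_unit_element_unique: "is_unit_element e \<Longrightarrow> (THE e. is_unit_element e) = e"
  by (rule the_equality) (auto simp: is_unit_element_def, metis)

lemma rng_of_nsmult_simps [simp]:
  "[(0::nat)] \<cdot>\<^bsub>rng_of\<^esub> x = (0::'a::ring)"
  "[(Suc n)] \<cdot>\<^bsub>rng_of\<^esub> x = [n] \<cdot>\<^bsub>rng_of\<^esub> x + (x::'a::ring)"
  by (simp_all add: add_pow_def rng_of_def nat_pow_def)

lemma rng_of_zsmult: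
  fixes x y :: "'a::ring" and m n :: int
  shows "[(0::int)] \<cdot>\<^bsub>rng_of\<^esub> x = 0"
    and "[(1::int)] \<cdot>\<^bsub>rng_of\<^esub> x = x"
    and "[(m + n)] \<cdot>\<^bsub>rng_of\<^esub> x = [m] \<cdot>\<^bsub>rng_of\<^esub> x + [n] \<cdot>\<^bsub>rng_of\<^esub> x"
    and "[(m * n)] \<cdot>\<^bsub>rng_of\<^esub> x = [m] \<cdot>\<^bsub>rng_of\<^esub> ([n] \<cdot>\<^bsub>rng_of\<^esub> x)"
    and "[m] \<cdot>\<^bsub>rng_of\<^esub> (x + y) = [m] \<cdot>\<^bsub>rng_of\<^esub> x + [m] \<cdot>\<^bsub>rng_of\<^esub> y"
    and "[m] \<cdot>\<^bsub>rng_of\<^esub> (x * y) = ([m] \<cdot>\<^bsub>rng_of\<^esub> x) * y"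
    and "[m] \<cdot>\<^bsub>rng_of\<^esub> (x * y) = x * ([m] \<cdot>\<^bsub>rng_of\<^esub> y)"
proof -
  interpret R: abelian_group "rng_of :: 'a ring" by (rule abelian_group_rng_of)
  have [simp]: "carrier rng_of = (UNIV :: 'a set)" "add rng_of = ((+) :: 'a \<Rightarrow> _)"
    "zero rng_of = (0::'a)"
    by (simp_all add: rng_of_def)
  have inv [simp]: "\<ominus>\<^bsub>rng_of\<^esub> z = - z" for z :: 'a
    using R.minus_equality[of "- z" z] by simp
  show "[(0::int)] \<cdot>\<^bsub>rng_of\<^esub> x = 0" by (simp add: add_pow_int_ge)
  show "[(1::int)] \<cdot>\<^bsub>rng_of\<^esub> x = x" using R.add.int_pow_1[of x] by simp
  show add: "[(m + n)] \<cdot>\<^bsub>rng_of\<^esub> x = [m] \<cdot>\<^bsub>rng_of\<^esub> x + [n] \<cdot>\<^bsub>rng_of\<^esub> x"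
    using R.add.int_pow_mult[of x m n] by simp
  show "[(m * n)] \<cdot>\<^bsub>rng_of\<^esub> x = [m] \<cdot>\<^bsub>rng_of\<^esub> ([n] \<cdot>\<^bsub>rng_of\<^esub> x)"
    using R.add.int_pow_pow[of x m n] by (simp add: mult.commute[of n m])
  show "[m] \<cdot>\<^bsub>rng_of\<^esub> (x + y) = [m] \<cdot>\<^bsub>rng_of\<^esub> x + [m] \<cdot>\<^bsub>rng_of\<^esub> y"
    using R.add.int_pow_distrib[of x y m] by simp
  have l: "[k] \<cdot>\<^bsub>rng_of\<^esub> (x * y) = ([k] \<cdot>\<^bsub>rng_of\<^esub> x) * y" for k :: nat
    by (induction k) (simp_all add: algebra_simps)
  have r: "[k] \<cdot>\<^bsub>rng_of\<^esub> (x * y) = x * ([k] \<cdot>\<^bsub>rng_of\<^esub> y)" for k :: nat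
    by (induction k) (simp_all add: algebra_simps)
  show "[m] \<cdot>\<^bsub>rng_of\<^esub> (x * y) = ([m] \<cdot>\<^bsub>rng_of\<^esub> x) * y"
    by (cases "m \<ge> 0") (simp_all add: add_pow_int_ge add_pow_int_lt l)
  show "[m] \<cdot>\<^bsub>rng_of\<^esub> (x * y) = x * ([m] \<cdot>\<^bsub>rng_of\<^esub> y)"
    by (cases "m \<ge> 0") (simp_all add: add_pow_int_ge add_pow_int_lt r)
qed

lemma rng_of_zsmult_zero: "[(m::int)] \<cdot>\<^bsub>rng_of\<^esub> (0::'a::ring) = 0"
  using rng_of_zsmult(5)[of m 0 0] by simp

lemma ring_unitization: "Ring.ring (unitization :: (int \<times> 'a::ring) ring)"
proof (rule ringI)
  let ?U = "unitization :: (int \<times> 'a) ring"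
  show "abelian_group ?U"
  proof (rule abelian_groupI)
    fix x assume "x \<in> carrier ?U"
    then show "\<exists>y\<in>carrier ?U. y \<oplus>\<^bsub>?U\<^esub> x = \<zero>\<^bsub>?U\<^esub>"
      by (intro bexI[of _ "(- fst x, - snd x)"])
        (auto simp: unitization_def split: if_splits prod.splits)
  qed (auto simp: unitization_def algebra_simps split: if_splits)
  have assoc: "x \<otimes>\<^bsub>?U\<^esub> y \<otimes>\<^bsub>?U\<^esub> z = x \<otimes>\<^bsub>?U\<^esub> (y \<otimes>\<^bsub>?U\<^esub> z)" for x y z
  proof -
    obtain i a j b k c where "x = (i, a)" "y = (j, b)" "z = (k, c)"
      by (metis surj_pair)
    moreover have
      "[k] \<cdot>\<^bsub>rng_of\<^esub> ([i] \<cdot>\<^bsub>rng_of\<^esub> b) = [i] \<cdot>\<^bsub>rng_of\<^esub> ([k] \<cdot>\<^bsub>rng_of\<^esub> b)"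
      by (metis mult.commute rng_of_zsmult(4))
    moreover have "[k] \<cdot>\<^bsub>rng_of\<^esub> ([j] \<cdot>\<^bsub>rng_of\<^esub> a) = [(j * k)] \<cdot>\<^bsub>rng_of\<^esub> a"
      by (metis mult.commute rng_of_zsmult(4))
    moreover have "([j] \<cdot>\<^bsub>rng_of\<^esub> a) * c = a * ([j] \<cdot>\<^bsub>rng_of\<^esub> c)"
      by (metis rng_of_zsmult(6,7))
    moreover have "([i] \<cdot>\<^bsub>rng_of\<^esub> b) * c = [i] \<cdot>\<^bsub>rng_of\<^esub> (b * c)"
      by (rule rng_of_zsmult(6)[symmetric])
    moreover have "a * ([k] \<cdot>\<^bsub>rng_of\<^esub> b) = [k] \<cdot>\<^bsub>rng_of\<^esub> (a * b)"
      by (rule rng_of_zsmult(7)[symmetric])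
    ultimately show ?thesis
      by (simp add: unitization_def rng_of_zsmult(4)[of i j] rng_of_zsmult(5) algebra_simps)
  qed
  show "Group.monoid ?U"
  proof (rule monoidI)
    fix x y assume "x \<in> carrier ?U" "y \<in> carrier ?U"
    then show "x \<otimes>\<^bsub>?U\<^esub> y \<in> carrier ?U"
      by (auto simp: unitization_def split: if_splits)
  next
    fix x assume "x \<in> carrier ?U"
    then show "\<one>\<^bsub>?U\<^esub> \<otimes>\<^bsub>?U\<^esub> x = x" "x \<otimes>\<^bsub>?U\<^esub> \<one>\<^bsub>?U\<^esub> = x"
      by (auto simp: unitization_def rng_of_zsmult rng_of_zsmult_zero is_unit_element_unique
          is_unit_element_def split: if_splits prod.splits)
  next
    show "\<And>x y z. x \<otimes>\<^bsub>?U\<^esub> y \<otimes>\<^bsub>?U\<^esub> z = x \<otimes>\<^bsub>?U\<^esub> (y \<otimes>\<^bsub>?U\<^esub> z)"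
      by (rule assoc)
  qed (auto simp: unitization_def)
qed (auto simp: unitization_def rng_of_zsmult algebra_simps split: if_splits prod.splits)

end

theory Submission
  imports Defs "HOL-Computational_Algebra.Polynomial"
begin

text \<open>
  The implication from (5) to (3) carries the content; it uses neither the scalar field nor the
  nilpotent elements. Let \<open>T = {x. [x, A] \<subseteq> V}\<close>, which is a subring since
  \<open>[xy, a] = [x, ya] + [y, ax]\<close>, and \<open>T\<^sub>2 = {x. [x, A] \<subseteq> T}\<close>. The products \<open>zz'\<close> with
  \<open>z, z' \<in> [T\<^sub>2, T]\<close> lie in the largest ideal \<open>J\<close> contained in \<open>T\<close>. If \<open>J\<close> were proper, it would
  lie in a non-exceptional prime \<open>P\<close>; these products then vanish modulo \<open>P\<close>, which forces
  \<open>[T\<^sub>2, T] \<subseteq> P\<close>. The key fact is that, modulo a non-exceptional prime, a subset \<open>W\<close> that is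
  stable under bracketing with commutators and has central brackets \<open>[W, W]\<close> is central. Applied
  to \<open>T\<^sub>2\<close>, then to \<open>T\<close> (as \<open>[T, T] \<subseteq> T\<^sub>2\<close>), then to \<open>V\<close> (as \<open>[V, V] \<subseteq> T\<close>), it makes \<open>V\<close> central
  modulo \<open>P\<close>, against full noncentrality. So \<open>J = A\<close> and \<open>[A, A] \<subseteq> V\<close>.

  For the key fact in characteristic \<open>2\<close>, a noncentral \<open>W\<close> yields elements \<open>t, c\<close> with \<open>[t, c]\<close>,
  \<open>t\<^sup>2\<close>, \<open>c\<^sup>2\<close> central and \<open>[t, c] \<noteq> 0\<close> that span a quaternion algebra over the center, which
  gives the identity \<open>s\<^sub>4\<close>.

  For (2) implies (5), conjugate by \<open>1 - tx\<close> for all scalars \<open>t\<close>: the result is a polynomial in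
  \<open>t\<close> with values in \<open>V\<close>, so its linear coefficient \<open>[x, a]\<close> is in \<open>V\<close>.
\<close>

section \<open>Commutators modulo a prime ideal\<close>

abbreviation bracket :: "'a::ring \<Rightarrow> 'a \<Rightarrow> 'a"  ("\<langle>_, _\<rangle>") where
  "\<langle>x, y\<rangle> \<equiv> commutator x y"

lemma commutator_mult_right: "\<langle>w, x * y\<rangle> = \<langle>w, x\<rangle> * y + x * \<langle>w, y\<rangle>"
  and commutator_mult_left: "\<langle>x * y, w\<rangle> = x * \<langle>y, w\<rangle> + \<langle>x, w\<rangle> * y"
  and commutator_add_right: "\<langle>w, x + y\<rangle> = \<langle>w, x\<rangle> + \<langle>w, y\<rangle>"
  and commutator_add_left: "\<langle>x + y, w\<rangle> = \<langle>x, w\<rangle> + \<langle>y, w\<rangle>"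
  and commutator_diff_right: "\<langle>w, x - y\<rangle> = \<langle>w, x\<rangle> - \<langle>w, y\<rangle>"
  and commutator_diff_left: "\<langle>x - y, w\<rangle> = \<langle>x, w\<rangle> - \<langle>y, w\<rangle>"
  and commutator_minus_right: "\<langle>w, - x\<rangle> = - \<langle>w, x\<rangle>"
  and commutator_minus_left: "\<langle>- x, w\<rangle> = - \<langle>x, w\<rangle>"
  and commutator_zero_right: "\<langle>w, 0\<rangle> = 0"
  and commutator_zero_left: "\<langle>0, w\<rangle> = 0"
  and commutator_self: "\<langle>x, x\<rangle> = 0"
  by (simp_all add: commutator_def algebra_simps)

lemmas commutator_expand = commutator_mult_right commutator_add_right commutator_add_left
  commutator_diff_right commutator_diff_left commutator_minus_right commutator_minus_left
  commutator_zero_right commutator_zero_left commutator_self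

lemma commutator_swap: "\<langle>x, y\<rangle> = - \<langle>y, x\<rangle>"
  by (simp add: commutator_def)

lemma jacobi: "\<langle>w, \<langle>x, y\<rangle>\<rangle> = \<langle>\<langle>w, x\<rangle>, y\<rangle> + \<langle>x, \<langle>w, y\<rangle>\<rangle>"
  by (simp add: commutator_def algebra_simps)

lemma additive_subgroup_ofD:
  assumes "additive_subgroup_of V"
  shows "0 \<in> V"
    and "x \<in> V \<Longrightarrow> y \<in> V \<Longrightarrow> x + y \<in> V"
    and "x \<in> V \<Longrightarrow> y \<in> V \<Longrightarrow> x - y \<in> V"
    and "x \<in> V \<Longrightarrow> - x \<in> V"
proof -
  show zero: "0 \<in> V" using assms by (simp add: additive_subgroup_of_def)
  have diff: "x - y \<in> V" if "x \<in> V" "y \<in> V" for x y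
    using assms that by (simp add: additive_subgroup_of_def)
  then show "x \<in> V \<Longrightarrow> y \<in> V \<Longrightarrow> x - y \<in> V" by simp
  have minus: "- x \<in> V" if "x \<in> V" for x
    using diff[OF zero that] by simp
  then show "x \<in> V \<Longrightarrow> - x \<in> V" by simp
  show "x + y \<in> V" if "x \<in> V" "y \<in> V"
    using diff[OF that(1) minus[OF that(2)]] by simp
qed

lemma two_sided_idealD:
  assumes "two_sided_ideal I"
  shows "0 \<in> I"
    and "x \<in> I \<Longrightarrow> y \<in> I \<Longrightarrow> x + y \<in> I"
    and "x \<in> I \<Longrightarrow> y \<in> I \<Longrightarrow> x - y \<in> I"
    and "x \<in> I \<Longrightarrow> - x \<in> I"
    and "x \<in> I \<Longrightarrow> a * x \<in> I"
    and "x \<in> I \<Longrightarrow> x * a \<in> I"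
  using assms additive_subgroup_ofD[of I] by (auto simp: two_sided_ideal_def)

section \<open>Primeness for elements\<close>

locale prime_quotient =
  fixes P :: "'a::ring set"
  assumes prime: "prime_ideal P"
begin

lemma ideal: "two_sided_ideal P"
  using prime by (simp add: prime_ideal_def)

lemmas mem_zero [simp] = two_sided_idealD(1)[OF ideal]
  and mem_add = two_sided_idealD(2)[OF ideal]
  and mem_diff = two_sided_idealD(3)[OF ideal]
  and mem_minus = two_sided_idealD(4)[OF ideal]
  and mem_mult_left = two_sided_idealD(5)[OF ideal]
  and mem_mult_right = two_sided_idealD(6)[OF ideal]

lemma mem_commutator_left: "x \<in> P \<Longrightarrow> \<langle>x, y\<rangle> \<in> P"
  and mem_commutator_right: "y \<in> P \<Longrightarrow> \<langle>x, y\<rangle> \<in> P"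
  by (simp_all add: commutator_def mem_diff mem_mult_left mem_mult_right)

lemmas mem_intros = mem_add mem_diff mem_minus mem_mult_left mem_mult_right
  mem_commutator_left mem_commutator_right

lemma mem_minus_iff: "- x \<in> P \<longleftrightarrow> x \<in> P"
  using mem_minus[of x] mem_minus[of "- x"] by auto

lemma mem_commutator_swap: "\<langle>x, y\<rangle> \<in> P \<Longrightarrow> \<langle>y, x\<rangle> \<in> P"
  by (subst commutator_swap) (rule mem_minus)

lemma prime_ideals:
  assumes "two_sided_ideal I" "two_sided_ideal J" "\<And>x y. x \<in> I \<Longrightarrow> y \<in> J \<Longrightarrow> x * y \<in> P"
  shows "I \<subseteq> P \<or> J \<subseteq> P"
  using prime assms unfolding prime_ideal_def by blast

text \<open>Without a unit, \<open>a\<close> need not be a sum of elements \<open>r a s\<close>, so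
  the argument runs through annihilators. The product \<open>K J\<close> lies in \<open>P\<close>,
  hence \<open>K\<close> or \<open>J\<close> does. As \<open>b\<close> is in \<open>J\<close>, the
  remaining case is \<open>K \<subseteq> P\<close>; then \<open>I A\<close> lies in
  \<open>K\<close>, hence in \<open>P\<close>, and primeness applies once more, to \<open>I\<close>
  and \<open>A\<close>.\<close>

lemma prime_elements:
  assumes "\<And>r. a * r * b \<in> P"
  shows "a \<in> P \<or> b \<in> P"
proof -
  define I where "I = {x. \<forall>r. x * r * b \<in> P}"
  define J where "J = {y. \<forall>x\<in>I. \<forall>r. x * r * y \<in> P}"
  define K where "K = {x. \<forall>y\<in>J. x * y \<in> P}"
  have I: "two_sided_ideal I"
    unfolding two_sided_ideal_def additive_subgroup_of_def I_def
    by (auto simp: left_diff_distrib mult.assoc intro: mem_intros) (metis mult.assoc)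
  have J: "two_sided_ideal J"
    unfolding two_sided_ideal_def additive_subgroup_of_def J_def
    by (auto simp: right_diff_distrib intro: mem_diff)
       (metis mult.assoc, metis mult.assoc mem_mult_right)
  have K: "two_sided_ideal K"
    unfolding two_sided_ideal_def additive_subgroup_of_def K_def
    by (auto simp: left_diff_distrib mult.assoc two_sided_idealD(5)[OF J] intro: mem_intros)
  have "a \<in> I" "b \<in> J"
    using assms by (auto simp: I_def J_def)
  have "K \<subseteq> P \<or> J \<subseteq> P"
    using prime_ideals[OF K J] by (auto simp: K_def)
  moreover have "a \<in> P" if "K \<subseteq> P"
  proof -
    have "x * r \<in> P" if "x \<in> I" for x r
      using that \<open>K \<subseteq> P\<close> by (auto simp: K_def J_def)
    moreover have "two_sided_ideal (UNIV :: 'a set)"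
      by (simp add: two_sided_ideal_def additive_subgroup_of_def)
    ultimately have "I \<subseteq> P \<or> (UNIV :: 'a set) \<subseteq> P"
      using prime_ideals[OF I] by blast
    then show ?thesis using \<open>a \<in> I\<close> by auto
  qed
  ultimately show ?thesis using \<open>b \<in> J\<close> by blast
qed

lemma prime_sandwich: "(\<And>r. a * r * a \<in> P) \<Longrightarrow> a \<in> P"
  using prime_elements by blast

section \<open>Congruence and centrality modulo the prime ideal\<close>

definition cong_mod :: "'a \<Rightarrow> 'a \<Rightarrow> bool"  (infix "\<approx>" 50) where
  "x \<approx> y \<longleftrightarrow> x - y \<in> P"

lemma cong_refl [simp]: "x \<approx> x"
  by (simp add: cong_mod_def)

lemma cong_sym: "x \<approx> y \<Longrightarrow> y \<approx> x"
  using mem_minus[of "x - y"] by (simp add: cong_mod_def)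

lemma cong_trans [trans]: "x \<approx> y \<Longrightarrow> y \<approx> z \<Longrightarrow> x \<approx> z"
  using mem_add[of "x - y" "y - z"] by (simp add: cong_mod_def)

lemma cong_zero_iff: "x \<approx> 0 \<longleftrightarrow> x \<in> P"
  by (simp add: cong_mod_def)

lemma cong_mem_iff: "x \<approx> y \<Longrightarrow> x \<in> P \<longleftrightarrow> y \<in> P"
  using cong_trans cong_sym cong_zero_iff by blast

lemma cong_add: "x \<approx> x' \<Longrightarrow> y \<approx> y' \<Longrightarrow> x + y \<approx> x' + y'"
  using mem_add[of "x - x'" "y - y'"] by (simp add: cong_mod_def algebra_simps)

lemma cong_diff: "x \<approx> x' \<Longrightarrow> y \<approx> y' \<Longrightarrow> x - y \<approx> x' - y'"
  using mem_diff[of "x - x'" "y - y'"] by (simp add: cong_mod_def algebra_simps)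

lemma cong_minus: "x \<approx> x' \<Longrightarrow> - x \<approx> - x'"
  using cong_diff[of 0 0] by simp

lemma cong_mult:
  assumes "x \<approx> x'" "y \<approx> y'"
  shows "x * y \<approx> x' * y'"
proof -
  have "x * y - x' * y' = (x - x') * y + x' * (y - y')"
    by (simp add: algebra_simps)
  then show ?thesis
    using assms by (simp add: cong_mod_def mem_intros)
qed

lemma cong_commutator: "x \<approx> x' \<Longrightarrow> y \<approx> y' \<Longrightarrow> \<langle>x, y\<rangle> \<approx> \<langle>x', y'\<rangle>"
  by (simp add: commutator_def cong_diff cong_mult)

lemmas cong_intros = cong_refl cong_add cong_diff cong_minus cong_mult cong_commutator

definition central :: "'a \<Rightarrow> bool" where
  "central z \<longleftrightarrow> (\<forall>x. \<langle>z, x\<rangle> \<in> P)"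

lemma central_commutator: "central z \<Longrightarrow> \<langle>z, x\<rangle> \<in> P" "central z \<Longrightarrow> \<langle>x, z\<rangle> \<in> P"
  by (auto simp: central_def intro: mem_commutator_swap)

lemma central_mult_comm: "central z \<Longrightarrow> z * x \<approx> x * z"
  by (simp add: central_def cong_mod_def commutator_def)

lemma mem_central: "x \<in> P \<Longrightarrow> central x"
  by (simp add: central_def mem_commutator_left)

lemma central_add: "central x \<Longrightarrow> central y \<Longrightarrow> central (x + y)"
  and central_diff: "central x \<Longrightarrow> central y \<Longrightarrow> central (x - y)"
  and central_minus: "central x \<Longrightarrow> central (- x)"
  and central_mult: "central x \<Longrightarrow> central y \<Longrightarrow> central (x * y)"
  by (simp_all add: central_def commutator_expand commutator_mult_left mem_intros)

lemma central_cong: "x \<approx> y \<Longrightarrow> central x \<longleftrightarrow> central y"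
  unfolding central_def using cong_commutator[of x y] cong_mem_iff cong_refl by blast

lemma central_cancel:
  assumes "central z" "z \<notin> P" "z * x \<in> P"
  shows "x \<in> P"
proof -
  have "z * r * x = \<langle>z, r\<rangle> * x + r * (z * x)" for r
    by (simp add: commutator_def algebra_simps)
  then have "z * r * x \<in> P" for r
    using assms by (simp add: central_commutator mem_intros)
  then show ?thesis using prime_elements assms(2) by blast
qed

lemma central_cancel_central:
  assumes "central z" "z \<notin> P" "central (z * x)"
  shows "central x"
  unfolding central_def
proof
  fix a
  have "z * \<langle>x, a\<rangle> = \<langle>z * x, a\<rangle> - \<langle>z, a\<rangle> * x"
    by (simp add: commutator_mult_left)
  also have "\<dots> \<in> P"
    using assms by (simp add: central_commutator mem_intros)
  finally show "\<langle>x, a\<rangle> \<in> P" using central_cancel assms by blast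
qed

lemma central_commutator_mult_left: "central z \<Longrightarrow> \<langle>z * x, y\<rangle> \<approx> z * \<langle>x, y\<rangle>"
  and central_commutator_mult_right: "central z \<Longrightarrow> \<langle>x, z * y\<rangle> \<approx> z * \<langle>x, y\<rangle>"
  by (simp_all add: cong_mod_def commutator_mult_left commutator_mult_right
      central_commutator mem_intros)

text \<open>By the Leibniz rule for \<open>[w, r x]\<close>, the vanishing products absorb a factor
  in the middle: \<open>[w, x] r [w, x]\<close> is in \<open>P\<close> for all
  \<open>r\<close>.\<close>

lemma central_if_products:
  assumes "\<And>x y. \<langle>w, x\<rangle> * \<langle>w, y\<rangle> \<in> P"
  shows "central w"
  unfolding central_def
proof
  fix x
  have "\<langle>w, x\<rangle> * r * \<langle>w, x\<rangle> \<in> P" for r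
  proof -
    have "\<langle>w, x\<rangle> * r * \<langle>w, x\<rangle> = \<langle>w, x\<rangle> * \<langle>w, r * x\<rangle> - \<langle>w, x\<rangle> * \<langle>w, r\<rangle> * x"
      by (simp add: commutator_expand algebra_simps)
    then show ?thesis using assms by (simp add: mem_intros)
  qed
  then show "\<langle>w, x\<rangle> \<in> P" by (rule prime_sandwich)
qed

text \<open>Bracketing \<open>[x, y w] = [x, y] w + y [x, w]\<close> with \<open>w\<close> leaves
  \<open>[w, y] [x, w]\<close> as the only term that does not contain a bracket of \<open>w\<close>
  with a commutator.\<close>

lemma central_if_commutes_commutators:
  assumes "\<And>x y. \<langle>w, \<langle>x, y\<rangle>\<rangle> \<in> P"
  shows "central w"
proof (rule central_if_products)
  fix y x
  have "\<langle>w, y\<rangle> * \<langle>w, x\<rangle> =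
      \<langle>w, \<langle>x, y\<rangle>\<rangle> * w - y * \<langle>w, \<langle>w, x\<rangle>\<rangle> - \<langle>w, \<langle>x, y * w\<rangle>\<rangle>"
    by (simp add: commutator_expand commutator_swap[of x w] algebra_simps)
  then show "\<langle>w, y\<rangle> * \<langle>w, x\<rangle> \<in> P"
    using assms by (simp add: mem_intros)
qed

end

section \<open>Characteristic other than two\<close>

context prime_quotient
begin

text \<open>A single \<open>g\<close> with \<open>2 g\<close> outside \<open>P\<close> lets 2 be
  cancelled everywhere, since \<open>x r (2 g) = (2 x) r g\<close>.\<close>

lemma odd_double_cancel:
  assumes "g + g \<notin> P" "x + x \<in> P"
  shows "x \<in> P"
proof -
  have "x * r * (g + g) = (x + x) * r * g" for r
    by (simp add: algebra_simps)
  then have "x * r * (g + g) \<in> P" for r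
    using assms(2) by (simp add: mem_intros)
  then show ?thesis using prime_elements assms(1) by blast
qed

lemma odd_double_cancel_central:
  assumes "g + g \<notin> P" "central (x + x)"
  shows "central x"
  unfolding central_def
proof
  fix a
  have "\<langle>x, a\<rangle> + \<langle>x, a\<rangle> \<in> P"
    using assms(2) by (simp add: central_def commutator_expand)
  then show "\<langle>x, a\<rangle> \<in> P" using odd_double_cancel assms(1) by blast
qed

text \<open>The derivation \<open>D = [w, _]\<close> has \<open>D^2\<close> vanishing on
  commutators, hence \<open>D^3 = 0\<close> modulo \<open>P\<close>. Evaluating \<open>D^2\<close>
  on \<open>[x, w y]\<close> gives a quadratic relation between values of \<open>D\<close>, which is
  bootstrapped to \<open>D x D y D z = 0\<close>. The Leibniz rule then inserts an arbitrary factor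
  before \<open>D z\<close>, so primeness shortens the product to \<open>D x D y\<close>.\<close>

lemma odd_central_if_double_commutators_vanish:
  assumes odd: "g + g \<notin> P" and vanish: "\<And>x y. \<langle>w, \<langle>w, \<langle>x, y\<rangle>\<rangle>\<rangle> \<in> P"
  shows "central w"
proof -
  define D where "D x = \<langle>w, x\<rangle>" for x
  have D_mult: "D (x * y) = D x * y + x * D y" and D_diff: "D (x - y) = D x - D y"
    and D_add: "D (x + y) = D x + D y" and D_w: "D w = 0" "D 0 = 0" for x y
    by (simp_all add: D_def commutator_expand)
  have D_mem: "D x \<in> P" if "x \<in> P" for x
    using that by (simp add: D_def mem_intros)
  have D3: "D (D (D x)) \<in> P" and D2: "D (D \<langle>x, y\<rangle>) \<in> P" for x y
    using vanish by (simp_all add: D_def)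
  have bracket_w: "\<langle>x, w * y\<rangle> = w * \<langle>x, y\<rangle> - D x * y" for x y
    by (simp add: D_def commutator_def algebra_simps)
  have two_term: "D (D x) * D y + D (D x) * D y + D x * D (D y) \<in> P" for x y
  proof -
    have "D (D x) * D y + D (D x) * D y + D x * D (D y) =
        w * D (D \<langle>x, y\<rangle>) - D (D (D x)) * y - D (D \<langle>x, w * y\<rangle>)"
      unfolding bracket_w D_mult D_diff D_add D_w by (simp add: D_mult D_add D_w algebra_simps)
    then show ?thesis using D2 D3 by (simp add: mem_intros)
  qed
  have triple: "D x * D y * D z \<in> P" for x y z
  proof (rule odd_double_cancel[OF odd])
    \<comment> \<open>Comparing how \<open>?E\<close> fails to be left linear in its first argument
      and right linear in its second leaves only twice the triple product.\<close>
    let ?E = "\<lambda>x y. D (D x) * D y + D (D x) * D y + D x * D (D y)"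
    have "D x * D y * D z + D x * D y * D z = ?E (x * y) z - x * ?E y z - (?E x (y * z) - ?E x y * z)"
      by (simp add: D_mult D_add algebra_simps)
    then show "D x * D y * D z + D x * D y * D z \<in> P"
      using two_term by (simp add: mem_intros)
  qed
  have sandwich: "D x * D y * r * D z \<in> P" for x y r z
  proof -
    have "D x * D y * r * D z = D x * D y * D (r * z) - D x * D y * D r * z"
      by (simp add: D_mult algebra_simps)
    then show ?thesis using triple by (simp add: mem_intros)
  qed
  show ?thesis
  proof (rule ccontr)
    assume nc: "\<not> central w"
    then obtain z where "D z \<notin> P" by (auto simp: central_def D_def)
    then have "D x * D y \<in> P" for x y
      using prime_elements[of "D x * D y" "D z"] sandwich by blast
    then have "central w" by (intro central_if_products) (simp add: D_def)
    then show False using nc by simp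
  qed
qed

text \<open>The hypothesis is tested on the commutator \<open>[u w w, u u]\<close>. Since
  \<open>[w, z]\<close> is in \<open>P\<close>, the Leibniz rule leaves twice \<open>M\<close>, and
  \<open>M\<close> reduces to \<open>4 z^3 w\<close>. With \<open>z\<close> outside \<open>P\<close>
  this makes \<open>w\<close> central, and then \<open>z = [w, u]\<close> lies in \<open>P\<close>
  after all.\<close>

lemma odd_double_commutators_vanish:
  assumes odd: "g + g \<notin> P" and cent: "\<And>x y. central \<langle>w, \<langle>w, \<langle>x, y\<rangle>\<rangle>\<rangle>"
  shows "\<langle>w, \<langle>w, \<langle>x, y\<rangle>\<rangle>\<rangle> \<in> P"
proof (rule ccontr)
  define u where "u = \<langle>w, \<langle>x, y\<rangle>\<rangle>"
  define z where "z = \<langle>w, u\<rangle>"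
  assume "\<langle>w, \<langle>w, \<langle>x, y\<rangle>\<rangle>\<rangle> \<notin> P"
  then have z: "z \<notin> P" "central z"
    using cent by (simp_all add: z_def u_def)
  define M where "M = \<langle>z * w * w, z * u + u * z\<rangle>"
  have zw: "\<langle>w, z\<rangle> \<in> P" and zz: "\<langle>t, z * z + z * z\<rangle> \<in> P" for t
    using z by (simp_all add: central_commutator central_add central_mult)
  \<comment> \<open>Up to the ideal, this is \<open>8 \<zeta>\<^sup>3 w\<close> with \<open>\<zeta> = [w, u]\<close>.\<close>
  have "\<langle>w, \<langle>w, \<langle>u * w * w, u * u\<rangle>\<rangle>\<rangle> - (M + M) =
      \<langle>\<langle>w, z\<rangle> * w * w, u * u\<rangle> + \<langle>u * w * w, \<langle>w, z\<rangle> * u + u * \<langle>w, z\<rangle>\<rangle> + \<langle>u * w * w, z * z + z * z\<rangle>"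
    unfolding M_def
    by (simp add: jacobi[of w] commutator_expand flip: z_def) (simp add: algebra_simps commutator_expand)
  also have "\<dots> \<in> P"
    using zw zz by (simp add: mem_intros)
  finally have "central (M + M)"
    using cent central_cong cong_mod_def by blast
  then have M: "central M" using odd_double_cancel_central odd by blast
  have "M \<approx> z * \<langle>w * w, z * u + u * z\<rangle>"
    unfolding M_def mult.assoc using z central_commutator_mult_left by blast
  also have "\<dots> \<approx> z * (\<langle>w * w, z * u\<rangle> + \<langle>w * w, z * u\<rangle>)"
    unfolding commutator_expand(2)[symmetric]
    by (intro cong_intros cong_sym[OF central_mult_comm] z)
  also have "\<dots> \<approx> z * (z * \<langle>w * w, u\<rangle> + z * \<langle>w * w, u\<rangle>)"
    by (intro cong_intros central_commutator_mult_right z)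
  also have "z * (z * \<langle>w * w, u\<rangle> + z * \<langle>w * w, u\<rangle>) =
      z * (z * (w * z + z * w) + z * (w * z + z * w))"
    by (simp add: commutator_mult_left flip: z_def)
  also have "\<dots> \<approx> z * (z * (z * w + z * w) + z * (z * w + z * w))"
    by (intro cong_intros cong_sym[OF central_mult_comm] z)
  also have "\<dots> = z * (z * (z * w)) + z * (z * (z * w)) + (z * (z * (z * w)) + z * (z * (z * w)))"
    by (simp add: algebra_simps)
  finally have "central (z * (z * (z * w)) + z * (z * (z * w)) + (z * (z * (z * w)) + z * (z * (z * w))))"
    using M central_cong by blast
  then have "central (z * (z * (z * w)))"
    using odd_double_cancel_central odd by blast
  then have "central w" using central_cancel_central z by blast
  then have "z \<in> P" by (simp add: z_def central_commutator)
  then show False using z by simp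
qed

end

section \<open>Quaternion algebras in characteristic two\<close>

context prime_quotient
begin

text \<open>In characteristic 2 the square of the adjoint map of \<open>w\<close> is the adjoint map
  of \<open>w w\<close>.\<close>

lemma even_double_commutator:
  assumes even: "\<And>x. x + x \<in> P" and "central (w * w)"
  shows "\<langle>w, \<langle>w, x\<rangle>\<rangle> \<in> P"
proof -
  let ?q = "x * w * w - w * x * w"
  have "\<langle>w, \<langle>w, x\<rangle>\<rangle> = \<langle>w * w, x\<rangle> + (?q + ?q)"
    by (simp add: commutator_def algebra_simps)
  then show ?thesis
    using even[of ?q] assms(2) by (simp add: central_def mem_intros)
qed

text \<open>In characteristic \<open>2\<close>, this is \<open>s\<^sub>4(p, q, r, s)\<close>.\<close>

definition s4_brackets :: "'a \<Rightarrow> 'a \<Rightarrow> 'a \<Rightarrow> 'a \<Rightarrow> 'a" where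
  "s4_brackets p q r s =
     \<langle>\<langle>p, q\<rangle>, \<langle>r, s\<rangle>\<rangle> + \<langle>\<langle>p, r\<rangle>, \<langle>q, s\<rangle>\<rangle> + \<langle>\<langle>p, s\<rangle>, \<langle>q, r\<rangle>\<rangle>"

end

text \<open>
  Modulo \<open>P\<close> and up to inverting the central element \<open>\<zeta> = [t, c]\<close>, the ring is a quaternion
  algebra spanned by \<open>1, t, c, tc\<close> over its center, with trace \<open>x \<mapsto> [t, [c, x]]\<close>.
\<close>

locale quaternion_quotient = prime_quotient +
  fixes t c :: 'a
  assumes even: "\<And>x. x + x \<in> P"
    and z_central: "central \<langle>t, c\<rangle>" and z_nonzero: "\<langle>t, c\<rangle> \<notin> P"
    and square_central: "central (t * t)" "central (c * c)"
    and centralizer_commutes: "\<And>r s. \<lbrakk>\<langle>t, r\<rangle> \<in> P; \<langle>c, r\<rangle> \<in> P; \<langle>t, s\<rangle> \<in> P; \<langle>c, s\<rangle> \<in> P\<rbrakk> \<Longrightarrow> \<langle>r, s\<rangle> \<in> P"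
begin

definition zeta :: 'a where "zeta = \<langle>t, c\<rangle>"

definition trace :: "'a \<Rightarrow> 'a" where "trace x = \<langle>t, \<langle>c, x\<rangle>\<rangle>"

lemma commutator_tc: "\<langle>t, c\<rangle> = zeta" "\<langle>c, t\<rangle> = - zeta"
  by (simp_all add: zeta_def commutator_swap[of c t])

lemma zeta: "central zeta" "zeta \<notin> P"
  using z_central z_nonzero by (simp_all add: zeta_def)

lemmas zeta_commutator = central_commutator[OF zeta(1)]

lemmas zeta_cancel = central_cancel[OF zeta]

lemmas double_commutator = even_double_commutator[OF even square_central(1)]
  even_double_commutator[OF even square_central(2)]

lemma trace_commutator: "\<langle>t, trace x\<rangle> \<in> P" "\<langle>c, trace x\<rangle> \<in> P"
proof -
  show "\<langle>t, trace x\<rangle> \<in> P" by (simp add: trace_def double_commutator)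
  show "\<langle>c, trace x\<rangle> \<in> P"
    by (simp add: trace_def jacobi[of c t] commutator_tc commutator_expand zeta_commutator
        double_commutator mem_intros)
qed

lemma commutator_ct: "\<langle>c, \<langle>t, x\<rangle>\<rangle> \<approx> trace x"
  by (simp add: cong_mod_def trace_def jacobi[of c t x] commutator_tc commutator_expand
      zeta_commutator mem_intros)

text \<open>\<open>t_part x\<close> and \<open>c_part x\<close> turn out to be central. They exhibit
  \<open>zeta [t, x]\<close> as a combination of 1 and \<open>t\<close>, and
  \<open>zeta [c, x]\<close> as one of 1 and \<open>c\<close>, the other coefficient being
  \<open>trace x\<close> up to sign.\<close>

definition t_part :: "'a \<Rightarrow> 'a" where "t_part x = zeta * \<langle>t, x\<rangle> + trace x * t"

definition c_part :: "'a \<Rightarrow> 'a" where "c_part x = zeta * \<langle>c, x\<rangle> - trace x * c"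

lemma t_part_commutator: "\<langle>t, t_part x\<rangle> \<in> P" "\<langle>c, t_part x\<rangle> \<in> P"
proof -
  show "\<langle>t, t_part x\<rangle> \<in> P"
    by (simp add: t_part_def commutator_expand zeta_commutator double_commutator trace_commutator
        mem_intros)
  have "\<langle>c, t_part x\<rangle> = \<langle>c, zeta\<rangle> * \<langle>t, x\<rangle> + zeta * (\<langle>c, \<langle>t, x\<rangle>\<rangle> - trace x) +
      \<langle>c, trace x\<rangle> * t + \<langle>zeta, trace x\<rangle>"
    by (simp add: t_part_def commutator_expand commutator_tc) (simp add: commutator_def algebra_simps)
  then show "\<langle>c, t_part x\<rangle> \<in> P"
    using commutator_ct by (simp add: cong_mod_def zeta_commutator trace_commutator mem_intros)
qed

lemma c_part_commutator: "\<langle>t, c_part x\<rangle> \<in> P" "\<langle>c, c_part x\<rangle> \<in> P"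
proof -
  show "\<langle>c, c_part x\<rangle> \<in> P"
    by (simp add: c_part_def commutator_expand zeta_commutator double_commutator trace_commutator
        mem_intros)
  have "\<langle>t, c_part x\<rangle> = \<langle>t, zeta\<rangle> * \<langle>c, x\<rangle> - \<langle>t, trace x\<rangle> * c + \<langle>zeta, trace x\<rangle>"
    by (simp add: c_part_def commutator_expand commutator_tc flip: trace_def)
       (simp add: commutator_def algebra_simps)
  then show "\<langle>t, c_part x\<rangle> \<in> P"
    by (simp add: zeta_commutator trace_commutator mem_intros)
qed

text \<open>The elements \<open>trace x\<close>, \<open>t_part x\<close> and \<open>c_part x\<close>
  lie in the common centralizer of \<open>t\<close> and \<open>c\<close>, which is commutative, so
  \<open>a\<close> commutes with them and hence with \<open>[t, x]\<close> and
  \<open>[c, x]\<close>. By Jacobi, \<open>[a, x]\<close> then commutes with \<open>t\<close> and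
  \<open>c\<close>. Replacing \<open>x\<close> by \<open>x t\<close> and bracketing with
  \<open>c\<close> yields \<open>zeta [a, x]\<close> up to sign.\<close>

lemma centralizer_central:
  assumes a: "\<langle>t, a\<rangle> \<in> P" "\<langle>c, a\<rangle> \<in> P"
  shows "central a"
  unfolding central_def
proof
  have a': "\<langle>a, t\<rangle> \<in> P" "\<langle>a, c\<rangle> \<in> P"
    using a by (simp_all add: mem_commutator_swap)
  have tr: "\<langle>a, trace x\<rangle> \<in> P" for x
    using centralizer_commutes a trace_commutator by blast
  have "\<langle>a, \<langle>t, x\<rangle>\<rangle> \<in> P" and "\<langle>a, \<langle>c, x\<rangle>\<rangle> \<in> P" for x
  proof -
    have "zeta * \<langle>a, \<langle>t, x\<rangle>\<rangle> =
        \<langle>a, t_part x\<rangle> - \<langle>a, zeta\<rangle> * \<langle>t, x\<rangle> - \<langle>a, trace x\<rangle> * t - trace x * \<langle>a, t\<rangle>"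
      by (simp add: t_part_def commutator_expand)
    also have "\<dots> \<in> P"
      using centralizer_commutes[OF a t_part_commutator] a' tr
      by (simp add: zeta_commutator mem_intros)
    finally show "\<langle>a, \<langle>t, x\<rangle>\<rangle> \<in> P" by (rule zeta_cancel)
    have "zeta * \<langle>a, \<langle>c, x\<rangle>\<rangle> =
        \<langle>a, c_part x\<rangle> - \<langle>a, zeta\<rangle> * \<langle>c, x\<rangle> + \<langle>a, trace x\<rangle> * c + trace x * \<langle>a, c\<rangle>"
      by (simp add: c_part_def commutator_expand)
    also have "\<dots> \<in> P"
      using centralizer_commutes[OF a c_part_commutator] a' tr
      by (simp add: zeta_commutator mem_intros)
    finally show "\<langle>a, \<langle>c, x\<rangle>\<rangle> \<in> P" by (rule zeta_cancel)
  qed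
  then have tax: "\<langle>t, \<langle>a, x\<rangle>\<rangle> \<in> P" and cax: "\<langle>c, \<langle>a, x\<rangle>\<rangle> \<in> P" for x
    using a by (simp_all add: jacobi[of _ a x] mem_intros)
  fix x
  have "zeta * \<langle>a, x\<rangle> = \<langle>zeta, \<langle>a, x\<rangle>\<rangle> + \<langle>c, \<langle>a, x\<rangle>\<rangle> * t + \<langle>c, x * \<langle>a, t\<rangle>\<rangle> - \<langle>c, \<langle>a, x * t\<rangle>\<rangle>"
    by (simp add: commutator_expand commutator_tc) (simp add: commutator_def algebra_simps)
  also have "\<dots> \<in> P"
    using cax a' by (simp add: zeta_commutator mem_intros)
  finally show "\<langle>a, x\<rangle> \<in> P" by (rule zeta_cancel)
qed

lemma trace_central: "central (trace x)"
  and t_part_central: "central (t_part x)"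
  and c_part_central: "central (c_part x)"
  by (simp_all add: centralizer_central trace_commutator t_part_commutator c_part_commutator)

lemma zeta_square_bracket: "\<langle>zeta * x, zeta * y\<rangle> \<approx> zeta * (zeta * \<langle>x, y\<rangle>)"
  by (rule cong_trans[OF central_commutator_mult_left])
     (intro cong_intros zeta central_commutator_mult_right)+

text \<open>As traces are central, the Leibniz rule reduces the claim to
  \<open>[[c, x], [t, y]]\<close> being symmetric in \<open>x\<close> and \<open>y\<close>. Up to
  the factor \<open>zeta^2\<close>, it is \<open>trace x trace y zeta\<close>.\<close>

lemma trace_bracket: "trace \<langle>x, y\<rangle> \<in> P"
proof -
  have eq: "zeta * \<langle>t, x\<rangle> = t_part x - trace x * t" "zeta * \<langle>c, x\<rangle> = c_part x + trace x * c" for x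
    by (simp_all add: t_part_def c_part_def)
  have 1: "zeta * (zeta * \<langle>\<langle>c, x\<rangle>, \<langle>t, y\<rangle>\<rangle>) \<approx> trace x * (trace y * zeta)" for x y
  proof -
    have "zeta * (zeta * \<langle>\<langle>c, x\<rangle>, \<langle>t, y\<rangle>\<rangle>) \<approx> \<langle>zeta * \<langle>c, x\<rangle>, zeta * \<langle>t, y\<rangle>\<rangle>"
      by (rule cong_sym[OF zeta_square_bracket])
    also have "\<dots> = \<langle>c_part x, t_part y - trace y * t\<rangle> + \<langle>trace x * c, t_part y\<rangle> - \<langle>trace x * c, trace y * t\<rangle>"
      unfolding eq commutator_add_left commutator_diff_right by (simp add: algebra_simps)
    also have "\<dots> \<approx> 0 + 0 - \<langle>trace x * c, trace y * t\<rangle>"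
      by (intro cong_intros) (simp_all add: cong_zero_iff central_commutator t_part_central c_part_central)
    also have "\<dots> \<approx> 0 + 0 - trace x * (trace y * \<langle>c, t\<rangle>)"
      by (intro cong_intros cong_trans[OF central_commutator_mult_left[OF trace_central]]
          central_commutator_mult_right trace_central)
    finally show ?thesis by (simp add: commutator_tc)
  qed
  have leibniz: "trace \<langle>x, y\<rangle> = \<langle>trace x, y\<rangle> + \<langle>x, trace y\<rangle>
      + \<langle>\<langle>c, x\<rangle>, \<langle>t, y\<rangle>\<rangle> - \<langle>\<langle>c, y\<rangle>, \<langle>t, x\<rangle>\<rangle>"
    by (simp add: trace_def commutator_def algebra_simps)
  have "zeta * (zeta * trace \<langle>x, y\<rangle>) = zeta * (zeta * \<langle>trace x, y\<rangle>) + zeta * (zeta * \<langle>x, trace y\<rangle>)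
      + zeta * (zeta * \<langle>\<langle>c, x\<rangle>, \<langle>t, y\<rangle>\<rangle>) - zeta * (zeta * \<langle>\<langle>c, y\<rangle>, \<langle>t, x\<rangle>\<rangle>)"
    by (simp add: leibniz algebra_simps)
  also have "\<dots> \<approx> 0 + 0 + trace x * (trace y * zeta) - trace y * (trace x * zeta)"
    by (intro cong_add cong_diff 1) (simp_all add: cong_zero_iff trace_central central_commutator mem_intros)
  also have "\<dots> = \<langle>trace x, trace y\<rangle> * zeta"
    by (simp add: commutator_def algebra_simps)
  also have "\<dots> \<approx> 0"
    by (simp add: cong_zero_iff trace_central central_commutator mem_intros)
  finally show ?thesis
    unfolding cong_zero_iff by (rule zeta_cancel[OF zeta_cancel])
qed

text \<open>On elements of trace zero the brackets with \<open>t\<close> and \<open>c\<close> are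
  central, so both sides can be computed from these brackets: after another factor
  \<open>zeta\<close> each becomes \<open>zeta ([t, a] [c, b] + [c, a] [t, b])\<close>.\<close>

lemma zeta_bracket_traceless:
  assumes a: "trace a \<in> P" and b: "trace b \<in> P"
  shows "zeta * \<langle>a, b\<rangle> \<approx> trace (a * b)"
proof -
  \<comment> \<open>For \<open>x\<close> of trace zero, \<open>zeta x\<close> is
    \<open>lin x\<close> plus a central element, so only \<open>lin\<close> matters for
    brackets.\<close>
  define lin where "lin x = \<langle>t, x\<rangle> * c - \<langle>c, x\<rangle> * t" for x
  have bc: "central \<langle>t, x\<rangle>" "central \<langle>c, x\<rangle>" if "trace x \<in> P" for x
  proof -
    have "central (t_part x - trace x * t)" "central (c_part x + trace x * c)"
      using that by (simp_all add: central_diff central_add t_part_central c_part_central mem_central mem_intros)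
    then show "central \<langle>t, x\<rangle>" "central \<langle>c, x\<rangle>"
      using central_cancel_central[OF zeta] by (simp_all add: t_part_def c_part_def)
  qed
  note ac = bc[OF a] and bc = bc[OF b]
  have lin: "central (zeta * x - lin x)" if "trace x \<in> P" "central \<langle>t, x\<rangle>" "central \<langle>c, x\<rangle>" for x
  proof (rule centralizer_central)
    have "\<langle>t, zeta * x - lin x\<rangle> = \<langle>t, zeta\<rangle> * x - \<langle>t, \<langle>t, x\<rangle>\<rangle> * c + trace x * t + \<langle>zeta, \<langle>t, x\<rangle>\<rangle>"
      by (simp add: lin_def trace_def commutator_expand commutator_tc)
         (simp add: commutator_def algebra_simps)
    then show "\<langle>t, zeta * x - lin x\<rangle> \<in> P"
      using that by (simp add: central_commutator zeta mem_intros)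
    have "\<langle>c, zeta * x - lin x\<rangle> = \<langle>c, zeta\<rangle> * x - \<langle>c, \<langle>t, x\<rangle>\<rangle> * c + \<langle>c, \<langle>c, x\<rangle>\<rangle> * t + \<langle>zeta, \<langle>c, x\<rangle>\<rangle>"
      by (simp add: lin_def trace_def commutator_expand commutator_tc)
         (simp add: commutator_def algebra_simps)
    then show "\<langle>c, zeta * x - lin x\<rangle> \<in> P"
      using that by (simp add: central_commutator zeta mem_intros)
  qed
  have lin_bracket: "\<langle>\<langle>t, a\<rangle> * c, \<langle>c, b\<rangle> * t\<rangle> \<approx> - (\<langle>t, a\<rangle> * (\<langle>c, b\<rangle> * zeta))"
    if "central \<langle>t, a\<rangle>" "central \<langle>c, b\<rangle>" for a b
  proof -
    have "\<langle>\<langle>t, a\<rangle> * c, \<langle>c, b\<rangle> * t\<rangle> \<approx> \<langle>t, a\<rangle> * (\<langle>c, b\<rangle> * \<langle>c, t\<rangle>)"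
      by (intro cong_intros cong_trans[OF central_commutator_mult_left] central_commutator_mult_right that)
    then show ?thesis by (simp add: commutator_tc)
  qed
  have same: "\<langle>u * x, v * x\<rangle> \<in> P" if "central u" "central v" for u v x
  proof -
    have "\<langle>u * x, v * x\<rangle> = u * \<langle>x, v\<rangle> * x + \<langle>u, v * x\<rangle> * x"
      by (simp add: commutator_expand commutator_mult_left algebra_simps)
    then show ?thesis using that by (simp add: central_commutator mem_intros)
  qed
  have "zeta * (zeta * \<langle>a, b\<rangle>) \<approx> \<langle>zeta * a, zeta * b\<rangle>"
    by (rule cong_sym[OF zeta_square_bracket])
  also have "\<dots> = \<langle>zeta * a - lin a, zeta * b\<rangle> + \<langle>lin a, zeta * b - lin b\<rangle> + \<langle>lin a, lin b\<rangle>"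
    by (simp add: commutator_expand algebra_simps)
  also have "\<dots> \<approx> 0 + 0 + \<langle>lin a, lin b\<rangle>"
    by (intro cong_intros) (simp_all add: cong_zero_iff central_commutator lin a b ac bc)
  also have "\<dots> = \<langle>\<langle>t, a\<rangle> * c, \<langle>t, b\<rangle> * c\<rangle> + \<langle>\<langle>c, a\<rangle> * t, \<langle>c, b\<rangle> * t\<rangle>
      + \<langle>\<langle>t, b\<rangle> * c, \<langle>c, a\<rangle> * t\<rangle> - \<langle>\<langle>t, a\<rangle> * c, \<langle>c, b\<rangle> * t\<rangle>"
    unfolding lin_def commutator_swap[of "\<langle>t, b\<rangle> * c" "\<langle>c, a\<rangle> * t"] commutator_diff_left commutator_diff_right
    by (simp add: algebra_simps)
  also have "\<dots> \<approx> 0 + 0 + - (\<langle>t, b\<rangle> * (\<langle>c, a\<rangle> * zeta)) - - (\<langle>t, a\<rangle> * (\<langle>c, b\<rangle> * zeta))"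
    by (intro cong_intros lin_bracket ac bc) (simp_all add: cong_zero_iff same ac bc)
  also have "\<dots> \<approx> zeta * (\<langle>t, a\<rangle> * \<langle>c, b\<rangle>) + zeta * (\<langle>c, a\<rangle> * \<langle>t, b\<rangle>)"
  proof -
    let ?q = "zeta * (\<langle>c, a\<rangle> * \<langle>t, b\<rangle>)"
    have eq: "0 + 0 + - (\<langle>t, b\<rangle> * (\<langle>c, a\<rangle> * zeta)) - - (\<langle>t, a\<rangle> * (\<langle>c, b\<rangle> * zeta))
        - (zeta * (\<langle>t, a\<rangle> * \<langle>c, b\<rangle>) + ?q) =
        zeta * \<langle>\<langle>c, a\<rangle>, \<langle>t, b\<rangle>\<rangle> + \<langle>\<langle>t, a\<rangle> * \<langle>c, b\<rangle>, zeta\<rangle>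
        - \<langle>\<langle>t, b\<rangle> * \<langle>c, a\<rangle>, zeta\<rangle> - (?q + ?q)"
      unfolding commutator_def[of "_ * _" zeta] commutator_def[of "\<langle>_, _\<rangle>" "\<langle>_, _\<rangle>"]
      by (simp add: algebra_simps)
    show ?thesis
      unfolding cong_mod_def eq
      by (intro mem_diff mem_add mem_mult_left even zeta_commutator central_commutator(1) ac)
  qed
  also have "\<dots> = zeta * trace (a * b) - zeta * (trace a * b) - zeta * (a * trace b)"
    by (simp add: trace_def commutator_expand algebra_simps)
  also have "\<dots> \<approx> zeta * trace (a * b) - 0 - 0"
    using a b by (intro cong_intros) (simp_all add: cong_zero_iff mem_intros)
  finally have "zeta * (zeta * \<langle>a, b\<rangle> - trace (a * b)) \<in> P"
    by (simp add: cong_mod_def algebra_simps)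
  then show ?thesis unfolding cong_mod_def by (rule zeta_cancel)
qed

text \<open>Commutators have trace zero, so each outer bracket becomes the trace of a product of two
  commutators. By Jacobi the sum of these products is a sum of commutators up to a multiple of 2,
  and its trace vanishes.\<close>

lemma s4_brackets_mem: "s4_brackets p q r s \<in> P"
proof (rule zeta_cancel)
  have trace_add: "trace (x + y) = trace x + trace y" for x y
    by (simp add: trace_def commutator_expand)
  let ?A = "\<langle>p, q\<rangle>" and ?B = "\<langle>r, s\<rangle>" and ?C = "\<langle>p, r\<rangle>" and ?D = "\<langle>q, s\<rangle>" and ?E = "\<langle>p, s\<rangle>" and ?F = "\<langle>q, r\<rangle>"
  let ?j = "p * \<langle>r, \<langle>q, s\<rangle>\<rangle>"
  have "zeta * s4_brackets p q r s = zeta * \<langle>?A, ?B\<rangle> + zeta * \<langle>?C, ?D\<rangle> + zeta * \<langle>?E, ?F\<rangle>"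
    by (simp add: s4_brackets_def algebra_simps)
  also have "\<dots> \<approx> trace (?A * ?B) + trace (?C * ?D) + trace (?E * ?F)"
    by (intro cong_intros zeta_bracket_traceless trace_bracket)
  also have "\<dots> = trace (?A * ?B + ?C * ?D + ?E * ?F)"
    by (simp add: trace_add)
  also have "?A * ?B + ?C * ?D + ?E * ?F =
      \<langle>p * ?B, q\<rangle> + \<langle>p * ?D, r\<rangle> + \<langle>p * ?F, s\<rangle> + (?j + ?j)"
    by (simp add: commutator_def algebra_simps)
  also have "trace \<dots> \<approx> 0"
    using trace_bracket even[of "trace ?j"] by (simp add: trace_add cong_zero_iff mem_intros)
  finally show "zeta * s4_brackets p q r s \<in> P"
    by (simp add: cong_zero_iff)
qed

end

section \<open>Noncentral elements in characteristic two\<close>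

context prime_quotient
begin

text \<open>The Leibniz rule gives three times the right-hand side, and 3 is 1 in characteristic
  2.\<close>

lemma even_cube_commutator:
  assumes even: "\<And>x. x + x \<in> P" and z: "central \<langle>t, c\<rangle>"
  shows "\<langle>t, c * c * c\<rangle> \<approx> \<langle>t, c\<rangle> * (c * c)"
proof -
  let ?z = "\<langle>t, c\<rangle>"
  have "\<langle>t, c * c * c\<rangle> - ?z * (c * c) = (c * c * ?z + c * c * ?z) + c * \<langle>?z, c\<rangle>"
    by (simp add: commutator_expand) (simp add: commutator_def algebra_simps)
  then show ?thesis
    using z even[of "c * c * ?z"]
    by (simp add: cong_mod_def central_commutator mem_intros)
qed

text \<open>In characteristic 2 the hypothesis says that bracketing with \<open>t = w w\<close>
  sends commutators to central elements. Some commutator \<open>c\<close> has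
  \<open>z = [t, c]\<close> outside \<open>P\<close>. Commutators are then chosen whose bracket with
  \<open>t\<close> is, up to sign, \<open>z^2\<close> times a prescribed element; that element is
  therefore central.\<close>

lemma s4_brackets_mem_if_square_not_central:
  assumes even: "\<And>x. x + x \<in> P" and cent: "\<And>x y. central \<langle>w, \<langle>w, \<langle>x, y\<rangle>\<rangle>\<rangle>"
    and "\<not> central (w * w)"
  shows "s4_brackets p q r s \<in> P"
proof -
  define t where "t = w * w"
  have cent_t: "central \<langle>t, \<langle>x, y\<rangle>\<rangle>" for x y
  proof -
    let ?c = "\<langle>x, y\<rangle>" and ?q = "w * \<langle>x, y\<rangle> * w - \<langle>x, y\<rangle> * w * w"
    have "\<langle>t, ?c\<rangle> - \<langle>w, \<langle>w, ?c\<rangle>\<rangle> = ?q + ?q"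
      unfolding t_def commutator_def[of w] commutator_def[of "w * w"] by (simp add: algebra_simps)
    then show ?thesis
      using even[of ?q] cent central_cong cong_mod_def by metis
  qed
  have "\<not> (\<forall>x y. \<langle>t, \<langle>x, y\<rangle>\<rangle> \<in> P)"
    using central_if_commutes_commutators[of t] assms(3) by (auto simp: t_def)
  then obtain x y where xy: "\<langle>t, \<langle>x, y\<rangle>\<rangle> \<notin> P" by blast
  define c where "c = \<langle>x, y\<rangle>"
  define z where "z = \<langle>t, c\<rangle>"
  have z: "central z" "z \<notin> P" using xy cent_t by (simp_all add: z_def c_def)
  have tc: "\<langle>t, c\<rangle> = z" "\<langle>c, t\<rangle> = - z" by (simp_all add: z_def commutator_swap[of c t])
  note zc = central_commutator[OF z(1)]
  have cancel: "central x" if "central (z * (z * x))" for x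
    using that central_cancel_central z by blast
  \<comment> \<open>This test commutator produces \<open>z^2 c^2\<close>; the next one,
    \<open>[c, t^3 c]\<close>, produces \<open>z^2 t^2\<close> up to sign.\<close>
  have "\<langle>t, \<langle>c * c * c * t, c\<rangle>\<rangle> = \<langle>t, c * c * c\<rangle> * z + c * c * c * \<langle>t, z\<rangle>"
    by (simp add: commutator_expand commutator_mult_left tc algebra_simps)
  also have "\<dots> \<approx> z * (c * c) * z + 0"
    using even_cube_commutator[OF even, of t c] z
    by (intro cong_intros) (simp_all add: tc cong_zero_iff zc mem_intros)
  also have "\<dots> \<approx> z * (z * (c * c))"
    using central_mult_comm[OF z(1), of "z * (c * c)"] cong_sym by simp
  finally have cc: "central (c * c)"
    using cancel cent_t central_cong by blast
  have "\<langle>t, \<langle>c, t * t * t * c\<rangle>\<rangle> = \<langle>t, \<langle>c, t * t * t\<rangle> * c\<rangle>"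
    by (simp add: commutator_mult_right commutator_self)
  also have "\<dots> \<approx> \<langle>t, (- z) * (t * t) * c\<rangle>"
    using even_cube_commutator[OF even, of c t] z
    by (intro cong_intros) (simp_all add: tc central_minus)
  also have "\<dots> = - (z * (t * t) * z) - \<langle>t, z\<rangle> * (t * t * c)"
    by (simp add: commutator_expand tc algebra_simps)
  also have "\<dots> \<approx> - (z * (t * t) * z) - 0"
    by (intro cong_intros) (simp_all add: cong_zero_iff zc mem_intros)
  also have "\<dots> \<approx> - (z * (z * (t * t)))"
    using cong_minus[OF central_mult_comm[OF z(1), of "z * (t * t)"]] cong_sym by simp
  finally have "central (- (z * (z * (t * t))))"
    using cent_t central_cong by blast
  then have tt: "central (t * t)"
    using cancel central_minus by fastforce
  interpret quaternion_quotient P t c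
  proof
    show "central \<langle>t, c\<rangle>" "\<langle>t, c\<rangle> \<notin> P" using z by (simp_all add: tc)
    fix a b assume a: "\<langle>t, a\<rangle> \<in> P" "\<langle>c, a\<rangle> \<in> P"
    have a': "\<langle>a, t\<rangle> \<in> P" "\<langle>a, c\<rangle> \<in> P" using a by (simp_all add: mem_commutator_swap)
    \<comment> \<open>For \<open>a\<close> commuting with \<open>t\<close> and \<open>c\<close> this
      test commutator produces \<open>z^2 a\<close>, so the centralizer is even central.\<close>
    have "\<langle>t, \<langle>c * t, a * c\<rangle>\<rangle> = a * z * z + \<langle>t, a\<rangle> * c * z + a * c * \<langle>t, z\<rangle>
        + \<langle>t, \<langle>c * t, a\<rangle> * c\<rangle>"
      by (simp add: commutator_expand commutator_mult_left tc algebra_simps)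
    also have "\<dots> \<approx> a * z * z + 0 + 0 + 0"
      using a a' by (intro cong_add cong_refl)
        (simp_all add: cong_zero_iff commutator_mult_left zc mem_intros)
    also have "\<dots> \<approx> z * a * z"
      using z by (simp add: cong_intros central_mult_comm cong_sym)
    also have "\<dots> \<approx> z * (z * a)"
      using central_mult_comm[OF z(1), of "z * a"] cong_sym by simp
    finally have "central a"
      using cancel cent_t central_cong by blast
    then show "\<langle>a, b\<rangle> \<in> P" by (simp add: central_commutator)
  qed (use even cc tt in auto)
  show ?thesis by (rule s4_brackets_mem)
qed

text \<open>Only the commutativity of the centralizer of \<open>t\<close> and \<open>c\<close> is
  left to prove. For \<open>a\<close>, \<open>b\<close> in it, the commutator
  \<open>[a t c, b]\<close> shows that \<open>k = [a, b]\<close> is central.\<close>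

lemma s4_brackets_mem_if_commutator_not_mem:
  assumes even: "\<And>x. x + x \<in> P" and cent: "\<And>x y. central \<langle>c, \<langle>t, \<langle>x, y\<rangle>\<rangle>\<rangle>"
    and sq: "central (t * t)" "central (c * c)" and z: "central \<langle>t, c\<rangle>" "\<langle>t, c\<rangle> \<notin> P"
  shows "s4_brackets p q r s \<in> P"
proof -
  define z where "z = \<langle>t, c\<rangle>"
  have z: "central z" "z \<notin> P" using assms by (simp_all add: z_def)
  have tc: "\<langle>t, c\<rangle> = z" "\<langle>c, t\<rangle> = - z" by (simp_all add: z_def commutator_swap[of c t])
  note zc = central_commutator[OF z(1)]
  interpret quaternion_quotient P t c
  proof
    have cent_ab: "central \<langle>a, b\<rangle>"
      if "\<langle>t, a\<rangle> \<in> P" "\<langle>c, a\<rangle> \<in> P" "\<langle>t, b\<rangle> \<in> P" "\<langle>c, b\<rangle> \<in> P" for a b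
    proof -
      let ?k = "\<langle>a, b\<rangle>"
      have k: "\<langle>t, ?k\<rangle> \<in> P" "\<langle>c, ?k\<rangle> \<in> P"
        using that by (simp_all add: jacobi[of _ a b] mem_intros)
      have b: "\<langle>t * c, b\<rangle> \<in> P"
        using that by (simp add: commutator_mult_left mem_intros)
      have "\<langle>c, \<langle>t, \<langle>a * (t * c), b\<rangle>\<rangle>\<rangle> =
          \<langle>c, \<langle>t, a * \<langle>t * c, b\<rangle>\<rangle>\<rangle> + \<langle>c, \<langle>t, ?k\<rangle> * t * c\<rangle> + \<langle>c, ?k\<rangle> * t * z + ?k * t * \<langle>c, z\<rangle> - ?k * z * z"
        by (simp only: commutator_mult_left) (simp add: commutator_expand tc algebra_simps)
      also have "\<dots> \<approx> 0 + 0 + 0 + 0 - ?k * z * z"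
        using k b by (intro cong_add cong_diff cong_refl) (simp_all add: cong_zero_iff zc mem_intros)
      also have "\<dots> = - (?k * z * z)" by simp
      also have "\<dots> \<approx> - (z * ?k * z)"
        using z by (intro cong_intros cong_sym[OF central_mult_comm])
      also have "\<dots> \<approx> - (z * (z * ?k))"
        using cong_minus[OF central_mult_comm[OF z(1), of "z * ?k"]] cong_sym by simp
      finally have "central (- (z * (z * ?k)))"
        using cent central_cong by blast
      then have "central (z * (z * ?k))"
        using central_minus by fastforce
      then show ?thesis using central_cancel_central z by blast
    qed
    fix a b assume ab: "\<langle>t, a\<rangle> \<in> P" "\<langle>c, a\<rangle> \<in> P" "\<langle>t, b\<rangle> \<in> P" "\<langle>c, b\<rangle> \<in> P"
    let ?k = "\<langle>a, b\<rangle>"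
    have k: "central ?k" using cent_ab ab by blast
    \<comment> \<open>Since \<open>a b\<close> is in the centralizer too,
      \<open>a k = [a, a b]\<close> is central; bracketing it with \<open>b\<close> gives
      \<open>k^2 = 0\<close>, so \<open>k = 0\<close> modulo \<open>P\<close>.\<close>
    have "central \<langle>a, a * b\<rangle>"
      using ab by (intro cent_ab) (simp_all add: commutator_mult_right mem_intros)
    then have "central (a * ?k)" by (simp add: commutator_expand)
    moreover have "?k * ?k = \<langle>a * ?k, b\<rangle> - a * \<langle>?k, b\<rangle>"
      by (simp add: commutator_mult_left)
    ultimately have "?k * ?k \<in> P"
      using k by (simp add: central_commutator mem_intros)
    then show "?k \<in> P" using central_cancel k by blast
  qed (use assms in auto)
  show ?thesis by (rule s4_brackets_mem)
qed

text \<open>The pair \<open>w\<close>, \<open>c\<close> generates the quaternion algebra. The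
  commutators \<open>[w c^3, c]\<close> and \<open>[b w c, c]\<close>, bracketed with
  \<open>w\<close>, give \<open>z^2 c^2\<close> and \<open>z^2 b\<close>, so everything commuting
  with \<open>w\<close> also commutes with \<open>c^2\<close> and with each \<open>b\<close> in the
  centralizer of \<open>w\<close> and \<open>c\<close>.\<close>

lemma s4_brackets_mem_if_kernel_commutes:
  assumes even: "\<And>x. x + x \<in> P" and sq: "central (w * w)"
    and ker: "\<And>h x y. \<langle>w, h\<rangle> \<in> P \<Longrightarrow> \<langle>h, \<langle>w, \<langle>x, y\<rangle>\<rangle>\<rangle> \<in> P"
    and z: "central \<langle>w, c\<rangle>" "\<langle>w, c\<rangle> \<notin> P"
  shows "s4_brackets p q r s \<in> P"
proof -
  define z where "z = \<langle>w, c\<rangle>"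
  have z: "central z" "z \<notin> P" using assms by (simp_all add: z_def)
  have wc: "\<langle>w, c\<rangle> = z" "\<langle>c, w\<rangle> = - z" by (simp_all add: z_def commutator_swap[of c w])
  note zc = central_commutator[OF z(1)]
  note ww = even_double_commutator[OF even sq]
  have cancel: "\<langle>h, x\<rangle> \<in> P" if "\<langle>h, z * (z * x)\<rangle> \<in> P" for h x
  proof -
    have "z * (z * \<langle>h, x\<rangle>) = \<langle>h, z * (z * x)\<rangle> - \<langle>h, z\<rangle> * (z * x) - z * \<langle>h, z\<rangle> * x"
      by (simp add: commutator_expand algebra_simps)
    also have "\<dots> \<in> P" using that by (simp add: zc mem_intros)
    finally show ?thesis using central_cancel z by blast
  qed
  have ker_cc: "\<langle>h, c * c\<rangle> \<in> P" if "\<langle>w, h\<rangle> \<in> P" for h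
  proof (rule cancel)
    have "\<langle>w, \<langle>w * (c * c * c), c\<rangle>\<rangle> = \<langle>w, z\<rangle> * (c * c * c) + z * \<langle>w, c * c * c\<rangle>"
    proof -
      have "\<langle>w * (c * c * c), c\<rangle> = z * (c * c * c)"
        by (simp add: z_def commutator_def algebra_simps)
      then show ?thesis by (simp add: commutator_mult_right)
    qed
    also have "\<dots> \<approx> 0 + z * (z * (c * c))"
      using even_cube_commutator[OF even, of w c] z
      by (intro cong_intros) (simp_all add: wc cong_zero_iff zc mem_intros)
    finally have "\<langle>h, \<langle>w, \<langle>w * (c * c * c), c\<rangle>\<rangle>\<rangle> \<approx> \<langle>h, z * (z * (c * c))\<rangle>"
      by (intro cong_commutator) simp_all
    then show "\<langle>h, z * (z * (c * c))\<rangle> \<in> P"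
      using ker[OF that] cong_mem_iff by blast
  qed
  have cc: "central (c * c)"
    unfolding central_def
  proof
    fix x
    \<comment> \<open>Both \<open>h\<close> and \<open>[w, x]\<close> commute with \<open>w\<close>,
      and \<open>z x = h + c [w, x]\<close>. So \<open>c c\<close> commutes with \<open>z x\<close>,
      hence with \<open>x\<close>.\<close>
    define h where "h = z * x - c * \<langle>w, x\<rangle>"
    have "\<langle>w, h\<rangle> \<in> P"
      by (simp add: h_def commutator_expand wc zc ww mem_intros)
    then have h: "\<langle>c * c, h\<rangle> \<in> P" and wx: "\<langle>c * c, \<langle>w, x\<rangle>\<rangle> \<in> P"
      using ker_cc ww by (auto intro: mem_commutator_swap)
    have "z * \<langle>c * c, x\<rangle> = \<langle>c * c, h\<rangle> + c * \<langle>c * c, \<langle>w, x\<rangle>\<rangle> - \<langle>c * c, z\<rangle> * x"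
      by (simp add: h_def commutator_expand commutator_mult_left[of c c c])
    also have "\<dots> \<in> P" using h wx by (simp add: zc mem_intros)
    finally show "\<langle>c * c, x\<rangle> \<in> P" using central_cancel z by blast
  qed
  interpret quaternion_quotient P w c
  proof
    fix a b assume ab: "\<langle>w, a\<rangle> \<in> P" "\<langle>c, a\<rangle> \<in> P" "\<langle>w, b\<rangle> \<in> P" "\<langle>c, b\<rangle> \<in> P"
    have "\<langle>w, \<langle>b * (w * c), c\<rangle>\<rangle> =
        \<langle>w, \<langle>b, c\<rangle> * (w * c)\<rangle> + \<langle>w, b\<rangle> * z * c + b * \<langle>w, z\<rangle> * c + \<langle>b, z\<rangle> * z + z * \<langle>b, z\<rangle> + z * (z * b)"
    proof -
      have "\<langle>b * (w * c), c\<rangle> = b * (z * c) + \<langle>b, c\<rangle> * (w * c)"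
        by (simp add: z_def commutator_def algebra_simps)
      then have "\<langle>w, \<langle>b * (w * c), c\<rangle>\<rangle> =
          \<langle>w, \<langle>b, c\<rangle> * (w * c)\<rangle> + \<langle>w, b\<rangle> * z * c + b * \<langle>w, z\<rangle> * c + b * z * z"
        by (simp add: commutator_expand wc algebra_simps)
      also have "b * z * z = \<langle>b, z\<rangle> * z + z * \<langle>b, z\<rangle> + z * (z * b)"
        by (simp add: commutator_def algebra_simps)
      finally show ?thesis by (simp add: add.assoc)
    qed
    also have "\<dots> \<approx> 0 + 0 + 0 + 0 + 0 + z * (z * b)"
      using ab by (intro cong_add cong_refl)
        (simp_all add: cong_zero_iff zc mem_commutator_swap mem_intros)
    finally have "\<langle>a, \<langle>w, \<langle>b * (w * c), c\<rangle>\<rangle>\<rangle> \<approx> \<langle>a, z * (z * b)\<rangle>"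
      by (intro cong_commutator) simp_all
    then show "\<langle>a, b\<rangle> \<in> P"
      using ker[OF ab(1)] cong_mem_iff cancel by blast
  qed (use assms cc in auto)
  show ?thesis by (rule s4_brackets_mem)
qed

text \<open>
  The adjoint maps of \<open>w\<close> and \<open>v\<close> satisfy the linear dependence relation
  \<open>[v, y] r [w, x] [w, s] \<equiv> [w, y] r [w, x] [v, s]\<close>.
\<close>

lemma kernel_subset_if_product_kills_commutators:
  assumes w: "\<not> central w" and ww: "\<And>x. \<langle>w, \<langle>w, x\<rangle>\<rangle> \<in> P" and wv: "\<langle>w, v\<rangle> \<in> P"
    and vanish: "\<And>x y. \<langle>w, \<langle>v, \<langle>x, y\<rangle>\<rangle>\<rangle> \<in> P" and h: "\<langle>w, h\<rangle> \<in> P"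
  shows "\<langle>v, h\<rangle> \<in> P"
proof -
  define D where "D x = \<langle>w, x\<rangle>" for x
  define E where "E x = \<langle>v, x\<rangle>" for x
  have simps: "D (x * y) = D x * y + x * D y" "E (x * y) = E x * y + x * E y"
    "D (x + y) = D x + D y" "E (x + y) = E x + E y" "D (x - y) = D x - D y" "E (x - y) = E x - E y"
    "D w = 0" "D 0 = 0" for x y
    by (simp_all add: D_def E_def commutator_expand)
  have mem: "x \<in> P \<Longrightarrow> D x \<in> P" "x \<in> P \<Longrightarrow> E x \<in> P" for x
    by (simp_all add: D_def E_def mem_intros)
  have DD: "D (D x) \<in> P" and DE_bracket: "D (E \<langle>x, y\<rangle>) \<in> P" for x y
    using ww vanish by (simp_all add: D_def E_def)
  have Ew: "E w \<in> P" using wv by (simp add: E_def mem_commutator_swap)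
  have comm: "D (E x) - E (D x) \<in> P" for x
    using wv by (simp add: D_def E_def jacobi[of w v x] mem_intros)
  have DED: "D (E (D x)) \<in> P" for x
    using mem_diff[OF DD[of "E x"] mem(1)[OF comm[of x]]] by (simp add: simps)
  have two_term: "D (E y) * D x + D y * D (E x) \<in> P" for x y
  proof -
    have bracket_w: "\<langle>x, y * w\<rangle> = \<langle>x, y\<rangle> * w - y * D x"
      by (simp add: D_def commutator_def algebra_simps)
    have "D (E y) * D x + D y * D (E x) =
        D (E \<langle>x, y\<rangle>) * w + D \<langle>x, y\<rangle> * E w + \<langle>x, y\<rangle> * D (E w) - E y * D (D x)
        + D y * (D (E x) - E (D x)) - y * D (E (D x)) - D (E \<langle>x, y * w\<rangle>)"
      unfolding bracket_w by (simp add: simps) (simp add: simps algebra_simps)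
    then show ?thesis
      using DE_bracket DD comm DED Ew by (simp add: mem mem_intros)
  qed
  have exchange: "E y * D x * D s - D y * D x * E s \<in> P" for x y s
  proof -
    \<comment> \<open>As in odd characteristic, the two linearity defects of the relation
      \<open>two_term\<close> are compared.\<close>
    let ?F = "\<lambda>x y. D (E y) * D x + D y * D (E x)"
    have "E y * D x * D s - D y * D x * E s =
        ?F s (y * x) - y * ?F s x - (?F (x * s) y - ?F x y * s)"
      by (simp add: simps algebra_simps)
    then show ?thesis using two_term by (simp add: mem_intros)
  qed
  have "E h * r * (D x * D s) \<in> P" for r x s
  proof -
    \<comment> \<open>Putting \<open>h r\<close> for \<open>y\<close> in the exchange relation frees
      the factor \<open>r\<close>; the term with \<open>D h\<close> vanishes.\<close>
    let ?H = "\<lambda>y x s. E y * D x * D s - D y * D x * E s"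
    have "E h * r * (D x * D s) = ?H (h * r) x s - h * ?H r x s + D h * r * D x * E s"
      by (simp add: simps algebra_simps)
    then show ?thesis using exchange h by (simp add: D_def mem_intros)
  qed
  moreover obtain x s where "D x * D s \<notin> P"
    using w central_if_products[of w] by (auto simp: D_def)
  ultimately show ?thesis
    using prime_elements E_def by metis
qed

text \<open>
  Here \<open>w x w\<close> generates a nil right ideal of bounded index, which vanishes in a prime ring.
\<close>

lemma square_zero_mem:
  assumes ww: "w * w \<in> P" and sq: "\<And>x y. \<langle>w, \<langle>x, y\<rangle>\<rangle> * \<langle>w, \<langle>x, y\<rangle>\<rangle> \<in> P"
  shows "w \<in> P"
proof (rule prime_sandwich)
  fix x
  define f where "f = w * x * w"
  have cube: "f * y * f * y * f \<in> P" for y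
  proof -
    let ?c = "\<langle>x, w * y\<rangle>"
    \<comment> \<open>As \<open>w w\<close> vanishes, \<open>[w, ?c]^2 w\<close> collapses to
      \<open>w ?c w ?c w\<close>, and \<open>w ?c w\<close> to \<open>f y w\<close>.\<close>
    have "w * ?c * w * ?c * w = \<langle>w, ?c\<rangle> * \<langle>w, ?c\<rangle> * w + w * ?c * ?c * (w * w)
        + ?c * (w * w) * ?c * w - ?c * w * ?c * (w * w)"
      by (simp only: commutator_def[of w ?c]) (simp add: algebra_simps)
    then have "w * ?c * w * ?c * w \<in> P"
      using ww sq by (simp add: mem_intros)
    moreover have "w * ?c * w = f * y * w - (w * w) * y * x * w"
      by (simp add: commutator_def f_def algebra_simps)
    then have wcw: "w * ?c * w \<approx> f * y * w"
      using ww by (simp add: cong_mod_def mem_intros)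
    have "w * ?c * w * (?c * w) \<approx> f * y * w * (?c * w)"
      by (rule cong_mult[OF wcw cong_refl])
    moreover have "f * y * w * (?c * w) = f * y * (w * ?c * w)"
      by (simp add: mult.assoc)
    moreover have "f * y * (w * ?c * w) \<approx> f * y * (f * y * w)"
      by (rule cong_mult[OF cong_refl wcw])
    ultimately have "f * y * (f * y * w) \<in> P"
      using cong_mem_iff by (simp add: mult.assoc)
    then have "f * y * (f * y * w) * (x * w) \<in> P" by (rule mem_mult_right)
    then show ?thesis by (simp add: f_def mult.assoc)
  qed
  have linear: "f * y * f * z * f + f * z * f * y * f \<in> P" for y z
  proof -
    have "f * y * f * z * f + f * z * f * y * f =
        f * (y + z) * f * (y + z) * f - f * y * f * y * f - f * z * f * z * f"
      by (simp add: algebra_simps)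
    then show ?thesis using cube by (simp add: mem_intros)
  qed
  have "f * y * f \<in> P" for y
  proof (rule prime_sandwich)
    fix z
    \<comment> \<open>The linearized relation is used with \<open>z f y\<close> in place of
      \<open>z\<close>, so that its second summand contains \<open>f y f y f\<close>.\<close>
    have "f * y * f * z * (f * y * f) =
        (f * y * f * (z * f * y) * f + f * (z * f * y) * f * y * f) - f * z * (f * y * f * y * f)"
      by (simp add: mult.assoc)
    then show "f * y * f * z * (f * y * f) \<in> P"
      using linear cube by (simp only: mem_intros)
  qed
  then show "w * x * w \<in> P" using prime_sandwich f_def by blast
qed

end

section \<open>Additive subgroups stable under commutators\<close>

context prime_quotient
begin

text \<open>In characteristic 2, each of the following could fail only if \<open>s4_brackets\<close>
  vanished modulo \<open>P\<close>: squares of elements of \<open>W\<close> are central, elements of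
  \<open>W\<close> commute, and \<open>[w, [x, y]]\<close> has square zero. For noncentral
  \<open>w\<close>, stability puts some \<open>[[x, y], w]\<close> outside \<open>P\<close> into
  \<open>W\<close>; it has square zero and its brackets with commutators do as well, which
  contradicts \<open>square_zero_mem\<close>.\<close>

lemma central_if_commutator_stable:
  assumes stable: "\<And>w x y. w \<in> W \<Longrightarrow> \<langle>\<langle>x, y\<rangle>, w\<rangle> \<in> W"
    and cent: "\<And>v w. \<lbrakk>v \<in> W; w \<in> W\<rbrakk> \<Longrightarrow> central \<langle>v, w\<rangle>"
    and nonexceptional: "(\<exists>g. g + g \<notin> P) \<or> (\<exists>p q r s. s4_brackets p q r s \<notin> P)"
    and "w \<in> W"
  shows "central w"
proof -
  have cent2: "central \<langle>v, \<langle>w, \<langle>x, y\<rangle>\<rangle>\<rangle>" if "v \<in> W" "w \<in> W" for v w x y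
    using cent[OF that(1) stable[OF that(2)], of x y] central_minus
    by (fastforce simp: commutator_swap[of w] commutator_minus_right)
  consider (odd) g where "g + g \<notin> P"
    | (even) p q r s where "\<And>x. x + x \<in> P" "s4_brackets p q r s \<notin> P"
    using nonexceptional by blast
  then show ?thesis
  proof cases
    case odd
    then have "\<langle>w, \<langle>w, \<langle>x, y\<rangle>\<rangle>\<rangle> \<in> P" for x y
      using odd_double_commutators_vanish cent2 \<open>w \<in> W\<close> by blast
    then show ?thesis
      using odd_central_if_double_commutators_vanish odd by blast
  next
    case even
    have sq: "central (w * w)" if "w \<in> W" for w
      using s4_brackets_mem_if_square_not_central[OF even(1), of w] cent2 that even(2) by blast
    have comm: "\<langle>v, w\<rangle> \<in> P" if "v \<in> W" "w \<in> W" for v w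
      using s4_brackets_mem_if_commutator_not_mem[OF even(1), of w v] cent2 cent sq that even(2) by blast
    have comm2: "\<langle>v, \<langle>w, \<langle>x, y\<rangle>\<rangle>\<rangle> \<in> P" if "v \<in> W" "w \<in> W" for v w x y
      using comm[OF that(1) stable[OF that(2)], of x y]
      by (simp add: commutator_swap[of w] commutator_minus_right mem_minus)
    note ww = even_double_commutator[OF even(1) sq]
    have ker: "\<langle>h, \<langle>w, \<langle>x, y\<rangle>\<rangle>\<rangle> \<in> P" if w: "w \<in> W" "\<not> central w" and h: "\<langle>w, h\<rangle> \<in> P" for w h x y
    proof -
      let ?v = "\<langle>\<langle>x, y\<rangle>, w\<rangle>"
      have "?v \<in> W" using stable w by blast
      then have "\<langle>?v, h\<rangle> \<in> P"
        using kernel_subset_if_product_kills_commutators[OF w(2) ww comm comm2 h] w(1) by blast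
      then show ?thesis
        by (simp add: commutator_swap[of h] commutator_swap[of w] commutator_minus_left mem_minus)
    qed
    have square: "\<langle>w, \<langle>x, y\<rangle>\<rangle> * \<langle>w, \<langle>x, y\<rangle>\<rangle> \<in> P" if w: "w \<in> W" for w x y
    proof (rule ccontr)
      define u where "u = \<langle>w, \<langle>x, y\<rangle>\<rangle>"
      assume nonzero: "\<langle>w, \<langle>x, y\<rangle>\<rangle> * \<langle>w, \<langle>x, y\<rangle>\<rangle> \<notin> P"
      then have uu: "u * u \<notin> P" by (simp add: u_def)
      then have nc: "\<not> central w"
        using central_commutator[of w] mem_mult_right by (auto simp: u_def)
      have "central (u * u)"
        using sq[OF stable[OF w]] by (simp add: u_def commutator_swap[of w])
      \<comment> \<open>The element \<open>u [x, y]\<close> serves as \<open>c\<close> in the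
        quaternion pair: since \<open>[w, u]\<close> is in \<open>P\<close>, its bracket with
        \<open>w\<close> is the central element \<open>u u\<close>.\<close>
      moreover have "\<langle>w, u * \<langle>x, y\<rangle>\<rangle> \<approx> u * u"
        using ww[OF w, of "\<langle>x, y\<rangle>", folded u_def]
        by (simp add: commutator_mult_right cong_mod_def mem_mult_right flip: u_def)
      ultimately have "central \<langle>w, u * \<langle>x, y\<rangle>\<rangle>" "\<langle>w, u * \<langle>x, y\<rangle>\<rangle> \<notin> P"
        using central_cong cong_mem_iff uu by blast+
      then show False
        using s4_brackets_mem_if_kernel_commutes[OF even(1) sq ker] w nc even(2) by blast
    qed
    show ?thesis
    proof (rule ccontr)
      assume "\<not> central w"
      then obtain x y where nz: "\<langle>w, \<langle>x, y\<rangle>\<rangle> \<notin> P"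
        using central_if_commutes_commutators by blast
      let ?v = "\<langle>\<langle>x, y\<rangle>, w\<rangle>"
      have v: "?v \<in> W" using stable \<open>w \<in> W\<close> by blast
      have "?v * ?v \<in> P"
        using square[OF \<open>w \<in> W\<close>, of x y] by (simp add: commutator_swap[of w])
      then have "?v \<in> P"
        using square_zero_mem square[OF v] by blast
      then show False using nz mem_commutator_swap by blast
    qed
  qed
qed

end

lemma commutator_span_subset_iff:
  assumes V: "additive_subgroup_of V"
  shows "commutator_span G H \<subseteq> V \<longleftrightarrow> (\<forall>g\<in>G. \<forall>h\<in>H. \<langle>g, h\<rangle> \<in> V)"
proof safe
  fix g h assume "commutator_span G H \<subseteq> V" "g \<in> G" "h \<in> H"
  moreover have "\<langle>g, h\<rangle> \<in> commutator_span G H"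
    unfolding commutator_span_def
    by (rule group_closure.base) (use \<open>g \<in> G\<close> \<open>h \<in> H\<close> in auto)
  ultimately show "\<langle>g, h\<rangle> \<in> V" by auto
next
  fix x assume *: "\<forall>g\<in>G. \<forall>h\<in>H. \<langle>g, h\<rangle> \<in> V" and "x \<in> commutator_span G H"
  from this(2) show "x \<in> V"
    unfolding commutator_span_def
  proof (induction rule: group_closure.induct)
    case (base s)
    then show ?case using * additive_subgroup_ofD(1)[OF V] by auto
  next
    case (diff s t)
    then show ?case by (intro additive_subgroup_ofD(3)[OF V])
  qed
qed

section \<open>Subrings and ideals attached to a commutator-stable subgroup\<close>

locale commutator_stable_subgroup =
  fixes V :: "'a::ring set"
  assumes subgroup: "additive_subgroup_of V"
    and commutator_stable: "v \<in> V \<Longrightarrow> \<langle>\<langle>x, y\<rangle>, v\<rangle> \<in> V"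
begin

lemmas mems = additive_subgroup_ofD[OF subgroup]

text \<open>With \<open>idealizer2\<close> and \<open>core\<close> below, these are the sets
  \<open>T\<close>, \<open>T\<^sub>2\<close> and \<open>J\<close> of the introduction.\<close>

definition idealizer :: "'a set" where
  "idealizer = {x. \<forall>a. \<langle>x, a\<rangle> \<in> V}"

definition idealizer2 :: "'a set" where
  "idealizer2 = {x. \<forall>a. \<langle>x, a\<rangle> \<in> idealizer}"

text \<open>The largest ideal inside \<open>idealizer\<close>. In the absence of a unit,
  \<open>x\<close>, \<open>a x\<close>, \<open>x a\<close> and \<open>a x b\<close> must be listed
  separately.\<close>

definition core :: "'a set" where
  "core = {x \<in> idealizer. \<forall>a b. a * x \<in> idealizer \<and> x * a \<in> idealizer \<and> a * x * b \<in> idealizer}"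

lemma commutator_stable': "v \<in> V \<Longrightarrow> \<langle>v, \<langle>x, y\<rangle>\<rangle> \<in> V"
  using commutator_stable[of v x y] mems(4) commutator_swap[of v] by simp

lemma idealizer_mems:
  "0 \<in> idealizer"
  "x \<in> idealizer \<Longrightarrow> y \<in> idealizer \<Longrightarrow> x + y \<in> idealizer"
  "x \<in> idealizer \<Longrightarrow> y \<in> idealizer \<Longrightarrow> x - y \<in> idealizer"
  "x \<in> idealizer \<Longrightarrow> - x \<in> idealizer"
  by (simp_all add: idealizer_def commutator_expand mems)

lemma idealizer_mult: "x \<in> idealizer \<Longrightarrow> y \<in> idealizer \<Longrightarrow> x * y \<in> idealizer"
proof -
  have "\<langle>x * y, a\<rangle> = \<langle>x, y * a\<rangle> + \<langle>y, a * x\<rangle>" for x y a :: 'a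
    by (simp add: commutator_def algebra_simps)
  then show "x \<in> idealizer \<Longrightarrow> y \<in> idealizer \<Longrightarrow> x * y \<in> idealizer"
    by (simp add: idealizer_def mems)
qed

lemma commutator_mem_idealizer: "v \<in> V \<Longrightarrow> w \<in> V \<Longrightarrow> \<langle>v, w\<rangle> \<in> idealizer"
proof -
  have "\<langle>\<langle>v, w\<rangle>, a\<rangle> = \<langle>v, \<langle>w, a\<rangle>\<rangle> - \<langle>w, \<langle>v, a\<rangle>\<rangle>" for a
    by (simp add: commutator_def algebra_simps)
  then show "v \<in> V \<Longrightarrow> w \<in> V \<Longrightarrow> \<langle>v, w\<rangle> \<in> idealizer"
    by (simp add: idealizer_def mems commutator_stable')
qed

lemma commutator_idealizer: "x \<in> idealizer \<Longrightarrow> v \<in> V \<Longrightarrow> \<langle>x, v\<rangle> \<in> idealizer"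
proof -
  have "\<langle>\<langle>x, v\<rangle>, a\<rangle> = \<langle>x, \<langle>v, a\<rangle>\<rangle> - \<langle>v, \<langle>x, a\<rangle>\<rangle>" for a
    by (simp add: commutator_def algebra_simps)
  then show "x \<in> idealizer \<Longrightarrow> v \<in> V \<Longrightarrow> \<langle>x, v\<rangle> \<in> idealizer"
    using commutator_stable' by (simp add: idealizer_def mems)
qed

lemma idealizer_commutator_stable: "x \<in> idealizer \<Longrightarrow> \<langle>\<langle>a, b\<rangle>, x\<rangle> \<in> idealizer"
proof -
  have "\<langle>\<langle>\<langle>a, b\<rangle>, x\<rangle>, d\<rangle> = \<langle>\<langle>a, b\<rangle>, \<langle>x, d\<rangle>\<rangle> - \<langle>x, \<langle>\<langle>a, b\<rangle>, d\<rangle>\<rangle>" for d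
    by (simp add: commutator_def algebra_simps)
  then show "x \<in> idealizer \<Longrightarrow> \<langle>\<langle>a, b\<rangle>, x\<rangle> \<in> idealizer"
    by (simp add: idealizer_def mems commutator_stable)
qed

lemma idealizer2_commutator_stable: "x \<in> idealizer2 \<Longrightarrow> \<langle>\<langle>a, b\<rangle>, x\<rangle> \<in> idealizer2"
proof -
  have "\<langle>\<langle>\<langle>a, b\<rangle>, x\<rangle>, d\<rangle> = \<langle>\<langle>a, b\<rangle>, \<langle>x, d\<rangle>\<rangle> - \<langle>x, \<langle>\<langle>a, b\<rangle>, d\<rangle>\<rangle>" for d
    by (simp add: commutator_def algebra_simps)
  then show "x \<in> idealizer2 \<Longrightarrow> \<langle>\<langle>a, b\<rangle>, x\<rangle> \<in> idealizer2"
    by (simp add: idealizer2_def idealizer_mems idealizer_commutator_stable)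
qed

lemma idealizer_commutator_mem_idealizer2:
  assumes x: "x \<in> idealizer" and y: "y \<in> idealizer"
  shows "\<langle>x, y\<rangle> \<in> idealizer2"
  unfolding idealizer2_def
proof safe
  fix a
  have "\<langle>\<langle>x, y\<rangle>, a\<rangle> = \<langle>x, \<langle>y, a\<rangle>\<rangle> - \<langle>y, \<langle>x, a\<rangle>\<rangle>"
    by (simp add: commutator_def algebra_simps)
  moreover have "\<langle>y, a\<rangle> \<in> V" "\<langle>x, a\<rangle> \<in> V" using x y by (simp_all add: idealizer_def)
  ultimately show "\<langle>\<langle>x, y\<rangle>, a\<rangle> \<in> idealizer"
    using commutator_idealizer x y idealizer_mems by simp
qed

text \<open>Solving the Leibniz rule for \<open>[x, y] a\<close> leaves \<open>[x, y a]\<close> and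
  \<open>y [x, a]\<close>, both in the subring \<open>idealizer\<close>. In a product of two such
  brackets each factor absorbs a multiplier on its own side, hence the product lies in
  \<open>core\<close>.\<close>

lemma bracket_mult_mem_idealizer:
  assumes x: "x \<in> idealizer2" and y: "y \<in> idealizer"
  shows "\<langle>x, y\<rangle> * a \<in> idealizer" "a * \<langle>x, y\<rangle> \<in> idealizer" "\<langle>x, y\<rangle> \<in> idealizer"
proof -
  have x': "\<langle>x, b\<rangle> \<in> idealizer" for b using x by (simp add: idealizer2_def)
  have "\<langle>x, y\<rangle> * a = \<langle>x, y * a\<rangle> - y * \<langle>x, a\<rangle>" "a * \<langle>x, y\<rangle> = \<langle>x, a * y\<rangle> - \<langle>x, a\<rangle> * y"
    by (simp_all add: commutator_expand)
  then show "\<langle>x, y\<rangle> * a \<in> idealizer" "a * \<langle>x, y\<rangle> \<in> idealizer" "\<langle>x, y\<rangle> \<in> idealizer"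
    using x' y by (simp_all only: idealizer_mems idealizer_mult)
qed

lemma core_ideal: "two_sided_ideal core"
  unfolding two_sided_ideal_def additive_subgroup_of_def core_def
  by (auto simp: idealizer_mems algebra_simps)
    (simp_all flip: mult.assoc)

lemma bracket_product_mem_core:
  assumes "x \<in> idealizer2" "y \<in> idealizer" "x' \<in> idealizer2" "y' \<in> idealizer"
  shows "\<langle>x, y\<rangle> * \<langle>x', y'\<rangle> \<in> core"
proof -
  note m = bracket_mult_mem_idealizer[OF assms(1,2)] bracket_mult_mem_idealizer[OF assms(3,4)]
  have "a * (\<langle>x, y\<rangle> * \<langle>x', y'\<rangle>) = (a * \<langle>x, y\<rangle>) * \<langle>x', y'\<rangle>"
    "\<langle>x, y\<rangle> * \<langle>x', y'\<rangle> * b = \<langle>x, y\<rangle> * (\<langle>x', y'\<rangle> * b)"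
    "a * (\<langle>x, y\<rangle> * \<langle>x', y'\<rangle>) * b = (a * \<langle>x, y\<rangle>) * (\<langle>x', y'\<rangle> * b)" for a b
    by (simp_all add: mult.assoc)
  then show ?thesis
    unfolding core_def using m idealizer_mult by simp
qed

end

locale commutator_stable_prime = commutator_stable_subgroup V + prime_quotient P for V P :: "'a::ring set"
begin

text \<open>All products of two elements of \<open>Z\<close> vanish modulo \<open>P\<close>. Given
  \<open>z\<close> in \<open>Z\<close> outside \<open>P\<close>, larger and larger sets inserted
  between elements of \<open>Z\<close> still give zero: first \<open>idealizer\<close>, then
  commutators, and finally products \<open>a z b\<close>, against primeness.\<close>

lemma bracket_mem_if_core_subset:
  assumes core: "core \<subseteq> P" and z: "x \<in> idealizer2" "y \<in> idealizer"
  shows "\<langle>x, y\<rangle> \<in> P"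
proof (rule ccontr)
  define Z where "Z = {\<langle>x, y\<rangle> |x y. x \<in> idealizer2 \<and> y \<in> idealizer}"
  have Z2: "v * w \<in> P" if "v \<in> Z" "w \<in> Z" for v w
    using that core bracket_product_mem_core by (auto simp: Z_def)
  have Z_mult: "v * a \<in> idealizer" "a * v \<in> idealizer" if "v \<in> Z" for v a
    using that bracket_mult_mem_idealizer by (auto simp: Z_def)
  have Z_sandwich: "v * r * w \<in> idealizer2" if "v \<in> Z" "w \<in> Z" for v w r
  proof -
    \<comment> \<open>Each product joins an element of \<open>Z\<close>, multiplied on its outer
      side, to one absorbing the remaining factors, so both lie in \<open>idealizer\<close>.\<close>
    have "\<langle>v * r * w, a\<rangle> = v * (r * w * a) - (a * v * r) * w" for a
      by (simp add: commutator_def mult.assoc)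
    then show ?thesis
      using that Z_mult by (simp add: idealizer2_def idealizer_mems)
  qed
  assume nz: "\<langle>x, y\<rangle> \<notin> P"
  define z where "z = \<langle>x, y\<rangle>"
  have z: "z \<in> Z" "z \<notin> P" using nz assms by (auto simp: z_def Z_def)
  have T: "v * t * w \<in> P" if "v \<in> Z" "w \<in> Z" "t \<in> idealizer" for v w t
  proof -
    have "z * r * (v * t * w) \<in> P" for r
    proof -
      have "\<langle>z * r * v, t\<rangle> \<in> Z"
        using Z_sandwich[OF z(1) that(1)] that(3) by (auto simp: Z_def)
      then have "\<langle>z * r * v, t\<rangle> * w \<in> P" using Z2 that by blast
      moreover have "z * r * (v * t * w) = \<langle>z * r * v, t\<rangle> * w + t * z * r * (v * w)"
        by (simp add: commutator_def algebra_simps)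
      ultimately show ?thesis using Z2 that by (simp add: mem_intros)
    qed
    then show ?thesis using prime_elements z(2) by blast
  qed
  have L: "z * \<langle>a, b\<rangle> * z \<in> P" for a b
  proof -
    have "z * \<langle>a, b\<rangle> * z * r * z \<in> P" for r
    proof -
      \<comment> \<open>Modulo \<open>P\<close>, this element between two factors \<open>z\<close>
        contributes only \<open>z [a, b] z r z\<close>, because \<open>z z\<close> vanishes.\<close>
      have "\<langle>\<langle>a, b\<rangle>, z * r\<rangle> \<in> idealizer"
        using Z_mult z idealizer_commutator_stable by blast
      then have "z * \<langle>\<langle>a, b\<rangle>, z * r\<rangle> * z \<in> P" using T z by blast
      moreover have "z * \<langle>a, b\<rangle> * z * r * z = z * \<langle>\<langle>a, b\<rangle>, z * r\<rangle> * z + z * z * r * \<langle>a, b\<rangle> * z"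
        unfolding commutator_def[of "\<langle>a, b\<rangle>"] by (simp add: algebra_simps)
      ultimately show ?thesis using Z2[OF z(1) z(1)] by (simp add: mem_intros)
    qed
    then show ?thesis using prime_elements z(2) by blast
  qed
  have "z * a * z * b * z \<in> P" for a b
  proof -
    have "z * a * z * b * z = z * \<langle>a, z * b\<rangle> * z + z * z * b * a * z"
      by (simp add: commutator_def algebra_simps)
    then show ?thesis using L Z2[OF z(1) z(1)] by (simp add: mem_intros)
  qed
  then have "z * a * z \<in> P" for a
    using prime_elements z(2) by blast
  then show False using prime_sandwich z(2) by blast
qed

lemma central_if_core_subset:
  assumes core: "core \<subseteq> P"
    and nonexceptional: "(\<exists>g. g + g \<notin> P) \<or> (\<exists>p q r s. s4_brackets p q r s \<notin> P)"
    and "v \<in> V"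
  shows "central v"
proof -
  note central_if_stable = central_if_commutator_stable[OF _ _ nonexceptional]
  have cent2: "central x" if "x \<in> idealizer2" for x
  proof (rule central_if_stable[OF idealizer2_commutator_stable _ that])
    fix x y assume xy: "x \<in> idealizer2" "y \<in> idealizer2"
    show "central \<langle>x, y\<rangle>"
      unfolding central_def
    proof
      fix a
      \<comment> \<open>Jacobi rewrites this as brackets of \<open>idealizer2\<close> with
        \<open>idealizer\<close>, which lie in \<open>P\<close>.\<close>
      have "\<langle>\<langle>x, y\<rangle>, a\<rangle> = \<langle>x, \<langle>y, a\<rangle>\<rangle> - \<langle>y, \<langle>x, a\<rangle>\<rangle>"
        by (simp add: commutator_def algebra_simps)
      moreover have "\<langle>y, a\<rangle> \<in> idealizer" "\<langle>x, a\<rangle> \<in> idealizer"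
        using xy by (simp_all add: idealizer2_def)
      ultimately show "\<langle>\<langle>x, y\<rangle>, a\<rangle> \<in> P"
        using bracket_mem_if_core_subset[OF core] xy by (simp add: mem_diff)
    qed
  qed
  have cent1: "central x" if "x \<in> idealizer" for x
    by (rule central_if_stable[OF idealizer_commutator_stable _ that])
      (auto intro: cent2 idealizer_commutator_mem_idealizer2)
  show ?thesis
    by (rule central_if_stable[OF commutator_stable _ \<open>v \<in> V\<close>])
      (auto intro: cent1 commutator_mem_idealizer)
qed

end

section \<open>The standard identity in the quotient ring\<close>

lemma sum_permutations_4:
  fixes f :: "'b \<Rightarrow> 'b \<Rightarrow> 'b \<Rightarrow> 'b \<Rightarrow> 'a::comm_monoid_add" and y :: "nat \<Rightarrow> 'b"
  shows "(\<Sum>\<sigma> | \<sigma> permutes {1..4}. f (y (\<sigma> 1)) (y (\<sigma> 2)) (y (\<sigma> 3)) (y (\<sigma> 4))) =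
    (let a = y 1; b = y 2; c = y 3; d = y 4 in
      f a b c d + f a b d c + f a c b d + f a c d b + f a d b c + f a d c b
    + f b a c d + f b a d c + f b c a d + f b c d a + f b d a c + f b d c a
    + f c a b d + f c a d b + f c b a d + f c b d a + f c d a b + f c d b a
    + f d a b c + f d a c b + f d b a c + f d b c a + f d c a b + f d c b a)"
proof -
  have range: "{1..4::nat} = {1, 2, 3, 4}" by auto
  have fin: "finite {2::nat, 3, 4}" "1 \<notin> {2::nat, 3, 4}" "finite {3::nat, 4}" "2 \<notin> {3::nat, 4}"
    "finite {4::nat}" "3 \<notin> {4::nat}"
    by auto
  show ?thesis
    unfolding range sum_over_permutations_insert[OF fin(1,2)] sum_over_permutations_insert[OF fin(3,4)]
      sum_over_permutations_insert[OF fin(5,6)] permutes_sing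
    by (simp add: transpose_def Let_def ac_simps)
qed

context prime_quotient
begin

abbreviation coset :: "'a \<Rightarrow> 'a set" where "coset a \<equiv> P +>\<^bsub>rng_of\<^esub> a"

abbreviation quot :: "'a set ring" where "quot \<equiv> rng_of Quot P"

lemma coset_eq: "coset a = {p + a |p. p \<in> P}"
  by (auto simp: a_r_coset_def r_coset_def rng_of_def)

lemma coset_eq_iff: "coset a = coset b \<longleftrightarrow> a \<approx> b"
proof
  assume "coset a = coset b"
  moreover have "a \<in> coset a" unfolding coset_eq by (rule CollectI, rule exI[of _ 0]) simp
  ultimately show "a \<approx> b" unfolding coset_eq cong_mod_def by auto
next
  have sub: "coset a \<subseteq> coset b" if "a \<approx> b" for a b
  proof
    fix x assume "x \<in> coset a"
    then obtain p where "p \<in> P" "x = p + a" by (auto simp: coset_eq)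
    then have "p + (a - b) \<in> P" "x = p + (a - b) + b"
      using that by (auto simp: cong_mod_def mem_add)
    then show "x \<in> coset b" unfolding coset_eq by blast
  qed
  assume "a \<approx> b"
  then show "coset a = coset b" using sub cong_sym by blast
qed

lemma abelian_subgroup: "abelian_subgroup P rng_of"
proof (rule abelian_subgroupI3)
  interpret R: abelian_group "rng_of :: 'a ring" by (rule abelian_group_rng_of)
  have "subgroup P (add_monoid rng_of)"
  proof (rule group.subgroupI[OF R.a_group])
    show "P \<noteq> {}" using mem_zero by blast
  next
    fix x assume "x \<in> P"
    moreover have "\<ominus>\<^bsub>rng_of\<^esub> x = - x"
      using R.minus_equality[of "- x" x] by (simp add: rng_of_def)
    ultimately show "inv\<^bsub>add_monoid rng_of\<^esub> x \<in> P"
      by (simp add: a_inv_def mem_minus)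
  qed (auto simp: rng_of_def mem_add)
  then show "additive_subgroup P rng_of" by (rule additive_subgroup.intro)
  show "abelian_group rng_of" by (rule abelian_group_rng_of)
qed

lemma quot_simps:
  "carrier quot = range coset" "zero quot = coset 0"
  "coset a \<oplus>\<^bsub>quot\<^esub> coset b = coset (a + b)" "coset a \<otimes>\<^bsub>quot\<^esub> coset b = coset (a * b)"
proof -
  interpret abelian_subgroup P rng_of by (rule abelian_subgroup)
  have rng_of [simp]: "carrier rng_of = (UNIV :: 'a set)" "add rng_of = ((+) :: 'a \<Rightarrow> 'a \<Rightarrow> 'a)"
    "monoid.mult rng_of = ((*) :: 'a \<Rightarrow> 'a \<Rightarrow> 'a)"
    by (simp_all add: rng_of_def)
  show "carrier quot = range coset"
    by (auto simp: FactRing_def A_RCOSETS_def')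
  show "zero quot = coset 0"
    by (simp add: FactRing_def coset_eq)
  show "coset a \<oplus>\<^bsub>quot\<^esub> coset b = coset (a + b)"
    using a_rcos_sum[of a b] by (simp add: FactRing_def)
  have "coset (u * v) = coset (a * b)" if "u \<in> coset a" "v \<in> coset b" for u v
  proof -
    have "u \<approx> a" "v \<approx> b" using that by (auto simp: coset_eq cong_mod_def)
    then show ?thesis by (simp add: coset_eq_iff cong_mult)
  qed
  moreover have "a \<in> coset a" "b \<in> coset b"
    unfolding coset_eq by (rule CollectI, rule exI[of _ 0], simp)+
  ultimately have "(\<Union>u\<in>coset a. \<Union>v\<in>coset b. coset (u * v)) = coset (a * b)"
    by blast
  then show "coset a \<otimes>\<^bsub>quot\<^esub> coset b = coset (a * b)"
    by (simp add: FactRing_def rcoset_mult_def)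
qed

lemma abelian_group_quot: "abelian_group quot"
proof -
  interpret abelian_subgroup P rng_of by (rule abelian_subgroup)
  show ?thesis
    by (rule comm_group_abelian_groupI)
      (simp add: FactRing_def a_factorgroup_is_comm_group[unfolded A_FactGroup_def'])
qed

lemma finsum_coset: "finite S \<Longrightarrow> (\<Oplus>\<^bsub>quot\<^esub> i \<in> S. coset (m i)) = coset (sum m S)"
proof (induction S rule: finite_induct)
  case empty
  interpret abelian_group quot by (rule abelian_group_quot)
  show ?case by (simp add: quot_simps)
next
  case (insert i S)
  interpret abelian_group quot by (rule abelian_group_quot)
  show ?case using insert by (subst finsum_insert) (auto simp: quot_simps)
qed

text \<open>With \<open>2 X = 0\<close> the signs disappear and the standard polynomial becomes the
  sum of all 24 monomials in representatives. Expanding \<open>s4_brackets\<close> gives the same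
  monomials with signs, and the difference is a multiple of 2.\<close>

lemma exceptional_quot:
  assumes even: "\<And>x. x + x \<in> P" and s4: "\<And>p q r s. s4_brackets p q r s \<in> P"
  shows "exceptional_ring quot"
proof -
  interpret abelian_group quot by (rule abelian_group_quot)
  have double: "X \<oplus>\<^bsub>quot\<^esub> X = zero quot" if X: "X \<in> carrier quot" for X
  proof -
    obtain a where "X = coset a" using X by (auto simp: quot_simps(1))
    then show ?thesis using even by (simp add: quot_simps coset_eq_iff cong_zero_iff)
  qed
  then have neg: "\<ominus>\<^bsub>quot\<^esub> X = X" if "X \<in> carrier quot" for X
    using that minus_equality by blast
  have sgn: "[sign \<sigma>] \<cdot>\<^bsub>quot\<^esub> X = X" if "X \<in> carrier quot" for X and \<sigma> :: "nat \<Rightarrow> nat"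
  proof (cases "sign \<sigma> = 1")
    case True
    then show ?thesis using add.int_pow_1[OF that] by simp
  next
    case False
    then have "sign \<sigma> = - 1" by (simp add: sign_def split: if_splits)
    then show ?thesis
      using add.int_pow_neg[OF that, of 1] add.int_pow_1[OF that] neg[OF that] by simp
  qed
  have "satisfies_s4 quot"
    unfolding satisfies_s4_def
  proof
    fix x assume x: "x \<in> {1..4::nat} \<rightarrow> carrier quot"
    define y where "y i = (SOME a. x i = coset a)" for i
    have y: "x i = coset (y i)" if "i \<in> {1..4}" for i
    proof -
      have "\<exists>a. x i = coset a" using x that by (fastforce simp: quot_simps(1))
      then show ?thesis unfolding y_def by (rule someI_ex)
    qed
    let ?S = "{\<sigma>. \<sigma> permutes {1..4::nat}}"
    let ?m = "\<lambda>\<sigma>. y (\<sigma> 1) * y (\<sigma> 2) * y (\<sigma> 3) * y (\<sigma> 4)"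
    have summand: "[sign \<sigma>] \<cdot>\<^bsub>quot\<^esub> (x (\<sigma> 1) \<otimes>\<^bsub>quot\<^esub> x (\<sigma> 2) \<otimes>\<^bsub>quot\<^esub> x (\<sigma> 3) \<otimes>\<^bsub>quot\<^esub> x (\<sigma> 4)) = coset (?m \<sigma>)"
      if "\<sigma> \<in> ?S" for \<sigma>
    proof -
      have "\<sigma> i \<in> {1..4}" if "i \<in> {1..4}" for i
        using that \<open>\<sigma> \<in> ?S\<close> permutes_in_image[of \<sigma> "{1..4}" i] by blast
      then have "x (\<sigma> 1) \<otimes>\<^bsub>quot\<^esub> x (\<sigma> 2) \<otimes>\<^bsub>quot\<^esub> x (\<sigma> 3) \<otimes>\<^bsub>quot\<^esub> x (\<sigma> 4) = coset (?m \<sigma>)"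
        by (simp add: y quot_simps)
      then show ?thesis using sgn[of "coset (?m \<sigma>)" \<sigma>] by (simp add: quot_simps)
    qed
    have "(\<Oplus>\<^bsub>quot\<^esub> \<sigma> \<in> ?S. [sign \<sigma>] \<cdot>\<^bsub>quot\<^esub>
        (x (\<sigma> 1) \<otimes>\<^bsub>quot\<^esub> x (\<sigma> 2) \<otimes>\<^bsub>quot\<^esub> x (\<sigma> 3) \<otimes>\<^bsub>quot\<^esub> x (\<sigma> 4))) =
        (\<Oplus>\<^bsub>quot\<^esub> \<sigma> \<in> ?S. coset (?m \<sigma>))"
      by (rule finsum_cong'[OF refl _ summand]) (simp_all add: quot_simps)
    also have "\<dots> = coset (sum ?m ?S)"
      by (rule finsum_coset) (simp add: finite_permutations)
    also have "\<dots> = coset 0"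
    proof -
      define p q r s where "p = y 1" "q = y 2" "r = y 3" "s = y 4"
      \<comment> \<open>The summands with a negative sign in the expansion of the brackets.\<close>
      define n where "n = p*q*s*r + q*p*r*s + r*s*p*q + s*r*q*p
        + p*r*s*q + r*p*q*s + q*s*p*r + s*q*r*p + p*s*r*q + s*p*q*r + q*r*p*s + r*q*s*p"
      have "sum ?m ?S = s4_brackets p q r s + (n + n)"
        unfolding sum_permutations_4[of "\<lambda>a b c d. a * b * c * d"] Let_def p_q_r_s_def[symmetric]
        by (simp add: s4_brackets_def commutator_def n_def algebra_simps)
      then show ?thesis
        using s4[of p q r s] even[of n] by (simp add: coset_eq_iff cong_zero_iff mem_add)
    qed
    finally show "(\<Oplus>\<^bsub>quot\<^esub> \<sigma> \<in> ?S. [sign \<sigma>] \<cdot>\<^bsub>quot\<^esub>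
        (x (\<sigma> 1) \<otimes>\<^bsub>quot\<^esub> x (\<sigma> 2) \<otimes>\<^bsub>quot\<^esub> x (\<sigma> 3) \<otimes>\<^bsub>quot\<^esub> x (\<sigma> 4))) = zero quot"
      by (simp add: quot_simps)
  qed
  then show ?thesis using double by (simp add: exceptional_ring_def)
qed

lemma nonexceptional:
  assumes "nonexceptional_prime_ideal P"
  shows "(\<exists>g. g + g \<notin> P) \<or> (\<exists>p q r s. s4_brackets p q r s \<notin> P)"
  using assms exceptional_quot prime
  unfolding nonexceptional_prime_ideal_def exceptional_prime_ideal_def by blast

end

section \<open>From submodules over commutators to all commutators\<close>

lemma commutators_subset_derived_submodule:
  fixes V :: "'a::ring set"
  assumes primes: "\<And>I :: 'a set. \<lbrakk>two_sided_ideal I; I \<noteq> UNIV\<rbrakk> \<Longrightarrow> \<exists>P. nonexceptional_prime_ideal P \<and> I \<subseteq> P"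
    and V: "derived_submodule V" and full: "fully_noncentral V"
  shows "commutator_span UNIV UNIV \<subseteq> V"
proof -
  have subgroup: "additive_subgroup_of V"
    using V by (simp add: derived_submodule_def)
  have "\<langle>x, y\<rangle> \<in> commutator_span UNIV UNIV" for x y :: 'a
    unfolding commutator_span_def by (rule group_closure.base) auto
  then interpret commutator_stable_subgroup V
    using V commutator_span_subset_iff[OF subgroup]
    by unfold_locales (auto simp: derived_submodule_def)
  have "core = UNIV"
  proof (rule ccontr)
    assume "core \<noteq> UNIV"
    then obtain P where P: "nonexceptional_prime_ideal P" "core \<subseteq> P"
      using primes core_ideal by blast
    then interpret commutator_stable_prime V P
      by unfold_locales (simp add: nonexceptional_prime_ideal_def)
    have "central v" if "v \<in> V" for v
      using central_if_core_subset[OF P(2) nonexceptional[OF P(1)] that] .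
    then have "commutator_span UNIV V \<subseteq> P"
      using ideal by (subst commutator_span_subset_iff)
        (auto simp: two_sided_ideal_def central_commutator)
    then show False
      using full ideal prime
      unfolding fully_noncentral_def Defs.full_def prime_ideal_def by blast
  qed
  then show ?thesis
    unfolding commutator_span_subset_iff[OF subgroup]
    by (auto simp: core_def idealizer_def)
qed

section \<open>Inner automorphisms and nilpotent elements\<close>

lemma to_unitization_simps:
  "to_unitization x \<in> carrier unitization"
  "zero unitization = to_unitization 0"
  "to_unitization x \<oplus>\<^bsub>unitization\<^esub> to_unitization y = to_unitization (x + y)"
  "to_unitization x \<otimes>\<^bsub>unitization\<^esub> to_unitization y = to_unitization (x * y)"
  "to_unitization x = to_unitization y \<longleftrightarrow> x = y"
  by (auto simp: to_unitization_def unitization_def rng_of_zsmult)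

lemma unitization_mult_mem_range:
  "v \<otimes>\<^bsub>unitization\<^esub> to_unitization a \<in> range to_unitization"
  by (cases v) (auto simp: to_unitization_def unitization_def)

text \<open>For \<open>w = (n, q)\<close> the integer part contributes \<open>n b\<close> to both
  products and cancels in the difference.\<close>

lemma unitization_commutator:
  obtains q where "\<And>b c d. \<lbrakk>to_unitization b \<otimes>\<^bsub>unitization\<^esub> w = to_unitization c;
    w \<otimes>\<^bsub>unitization\<^esub> to_unitization b = to_unitization d\<rbrakk> \<Longrightarrow> c - d = \<langle>b, q\<rangle>"
proof -
  obtain n q where "w = (n, q)" by (cases w)
  then show thesis
    by (intro that[of q])
      (auto simp: to_unitization_def unitization_def rng_of_zsmult commutator_def)
qed

text \<open>With \<open>b = v a\<close>, an element of \<open>A\<close>, the difference of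
  \<open>v a v^-1\<close> and \<open>a\<close> is the commutator of \<open>b\<close> and
  \<open>v^-1\<close> in the unitization, hence a commutator in \<open>A\<close>.\<close>

lemma commutators_subset_imp_inner_invariant:
  assumes V: "additive_subgroup_of V" and comm: "\<And>x y. \<langle>x, y\<rangle> \<in> V"
    and inner: "inner_automorphism \<alpha>"
  shows "invariant_under V \<alpha>"
proof -
  interpret U: Ring.ring "unitization :: (int \<times> 'a) ring" by (rule ring_unitization)
  obtain v where v: "v \<in> Units unitization"
    and \<alpha>: "\<And>a. to_unitization (\<alpha> a) =
      v \<otimes>\<^bsub>unitization\<^esub> to_unitization a \<otimes>\<^bsub>unitization\<^esub> inv\<^bsub>unitization\<^esub> v"
    using inner by (auto simp: inner_automorphism_def)
  let ?w = "inv\<^bsub>unitization\<^esub> v"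
  obtain q where q: "\<And>b c d. \<lbrakk>to_unitization b \<otimes>\<^bsub>unitization\<^esub> ?w = to_unitization c;
      ?w \<otimes>\<^bsub>unitization\<^esub> to_unitization b = to_unitization d\<rbrakk> \<Longrightarrow> c - d = \<langle>b, q\<rangle>"
    using unitization_commutator by blast
  have "\<alpha> a \<in> V" if a: "a \<in> V" for a
  proof -
    obtain b where b: "v \<otimes>\<^bsub>unitization\<^esub> to_unitization a = to_unitization b"
      using unitization_mult_mem_range by blast
    have "?w \<otimes>\<^bsub>unitization\<^esub> to_unitization b = to_unitization a"
      using v U.m_assoc[of ?w v "to_unitization a"]
      by (simp add: to_unitization_simps(1) U.Units_closed flip: b)
    then have "\<alpha> a - a = \<langle>b, q\<rangle>"
      using q \<alpha>[of a] b by metis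
    then have "\<alpha> a = a + \<langle>b, q\<rangle>" by (simp add: algebra_simps)
    then show ?thesis
      using additive_subgroup_ofD(2)[OF V a comm] by simp
  qed
  then show ?thesis by (auto simp: invariant_under_def)
qed

lemma (in Ring.ring) geometric_sum:
  assumes x: "x \<in> carrier R"
  shows "(\<Oplus>i\<in>{..<k}. x [^] (i::nat)) \<otimes> (\<one> \<ominus> x) = \<one> \<ominus> x [^] k"
    and "(\<one> \<ominus> x) \<otimes> (\<Oplus>i\<in>{..<k}. x [^] i) = \<one> \<ominus> x [^] k"
proof (induction k)
  case 0
  { case 1 then show ?case using x by (simp add: minus_eq r_neg) }
  { case 2 then show ?case using x by (simp add: minus_eq r_neg) }
next
  case (Suc k)
  let ?s = "\<Oplus>i\<in>{..<k}. x [^] i"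
  have s: "(\<Oplus>i\<in>{..<Suc k}. x [^] i) = x [^] k \<oplus> ?s"
    unfolding lessThan_Suc using x by (subst finsum_insert) auto
  have c: "?s \<in> carrier R" using x by (auto intro: finsum_closed)
  { case 1
    have "(x [^] k \<oplus> ?s) \<otimes> (\<one> \<ominus> x) = x [^] k \<otimes> (\<one> \<ominus> x) \<oplus> ?s \<otimes> (\<one> \<ominus> x)"
      using x c by (simp add: l_distr)
    also have "x [^] k \<otimes> (\<one> \<ominus> x) = \<ominus> (x [^] Suc k) \<oplus> x [^] k"
      using x by (simp add: minus_eq r_distr r_minus a_comm)
    finally show ?case
      using x unfolding s Suc.IH by (simp add: minus_eq a_ac r_neg1 r_neg2) }
  { case 2
    have "(\<one> \<ominus> x) \<otimes> (x [^] k \<oplus> ?s) = (\<one> \<ominus> x) \<otimes> x [^] k \<oplus> (\<one> \<ominus> x) \<otimes> ?s"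
      using x c by (simp add: r_distr)
    also have "(\<one> \<ominus> x) \<otimes> x [^] k = \<ominus> (x [^] Suc k) \<oplus> x [^] k"
      using x nat_pow_Suc2[OF x, of k] by (simp add: minus_eq l_distr l_minus a_comm)
    finally show ?case
      using x unfolding s Suc.IH by (simp add: minus_eq a_ac r_neg1 r_neg2) }
qed

text \<open>Iterated left multiplication by \<open>x\<close> expresses \<open>x^i a\<close> inside
  \<open>A\<close>, including \<open>i = 0\<close>, where \<open>A\<close> may lack the power
  itself.\<close>

lemma power_mult_to_unitization:
  "to_unitization x [^]\<^bsub>unitization\<^esub> (i::nat) \<otimes>\<^bsub>unitization\<^esub> to_unitization a =
     to_unitization (((*) x ^^ i) a)"
proof (induction i arbitrary: a)
  interpret U: Ring.ring "unitization :: (int \<times> 'a) ring" by (rule ring_unitization)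
  case 0
  show ?case by (simp add: to_unitization_simps)
next
  interpret U: Ring.ring "unitization :: (int \<times> 'a) ring" by (rule ring_unitization)
  case (Suc i)
  show ?case
    using Suc[of "x * a"] by (simp add: to_unitization_simps U.m_assoc funpow_swap1)
qed

lemma power_vanishes_Suc: "power_vanishes x (Suc j) \<longleftrightarrow> ((*) x ^^ j) x = 0"
proof -
  interpret U: Ring.ring "unitization :: (int \<times> 'a) ring" by (rule ring_unitization)
  show ?thesis
    using power_mult_to_unitization[of x j x] by (simp add: power_vanishes_def to_unitization_simps)
qed

lemma nilpotent_conjugate_eq:
  "nilpotent_conjugate x k a = to_unitization (\<Sum>i<k. ((*) x ^^ i) a - ((*) x ^^ i) a * x)"
proof -
  interpret U: Ring.ring "unitization :: (int \<times> 'a) ring" by (rule ring_unitization)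
  let ?X = "to_unitization x"
  let ?s = "\<lambda>k. \<Oplus>\<^bsub>unitization\<^esub>i\<in>{..<k}. ?X [^]\<^bsub>unitization\<^esub> (i::nat)"
  have c [simp]: "to_unitization y \<in> carrier unitization" for y :: 'a
    by (rule to_unitization_simps)
  have sc: "?s k \<in> carrier unitization" for k by (rule U.finsum_closed) auto
  have sum: "?s k \<otimes>\<^bsub>unitization\<^esub> to_unitization a = to_unitization (\<Sum>i<k. ((*) x ^^ i) a)"
  proof (induction k)
    case 0
    show ?case by (simp add: to_unitization_simps)
  next
    case (Suc k)
    have "?s (Suc k) = ?X [^]\<^bsub>unitization\<^esub> k \<oplus>\<^bsub>unitization\<^esub> ?s k"
      unfolding lessThan_Suc by (subst U.finsum_insert) auto
    then show ?case
      using Suc sc by (simp add: U.l_distr power_mult_to_unitization to_unitization_simps add.commute)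
  qed
  have minus: "\<ominus>\<^bsub>unitization\<^esub> to_unitization y = to_unitization (- y)" for y :: 'a
    using U.minus_equality[of "to_unitization (- y)" "to_unitization y"]
    by (simp add: to_unitization_simps)
  have "to_unitization b \<otimes>\<^bsub>unitization\<^esub> (\<one>\<^bsub>unitization\<^esub> \<ominus>\<^bsub>unitization\<^esub> ?X) = to_unitization (b - b * x)" for b
    by (simp add: U.minus_eq U.r_distr U.r_minus to_unitization_simps minus)
  then show ?thesis
    by (simp add: nilpotent_conjugate_def sum sum_subtractf sum_distrib_right)
qed

text \<open>When \<open>x^k = 0\<close>, the geometric series makes
  \<open>1 + x + ... + x^(k-1)\<close> a unit with inverse \<open>1 - x\<close>.\<close>

lemma inner_invariant_imp_nilpotent_conjugate:
  assumes inner: "\<And>\<alpha>. inner_automorphism \<alpha> \<Longrightarrow> invariant_under V \<alpha>"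
    and x: "power_vanishes x k" and a: "a \<in> V"
  shows "nilpotent_conjugate x k a \<in> to_unitization ` V"
proof -
  interpret U: Ring.ring "unitization :: (int \<times> 'a) ring" by (rule ring_unitization)
  let ?X = "to_unitization x"
  let ?v = "\<Oplus>\<^bsub>unitization\<^esub>i\<in>{..<k}. ?X [^]\<^bsub>unitization\<^esub> i"
  let ?w = "\<one>\<^bsub>unitization\<^esub> \<ominus>\<^bsub>unitization\<^esub> ?X"
  define \<alpha> where "\<alpha> a = (\<Sum>i<k. ((*) x ^^ i) a - ((*) x ^^ i) a * x)" for a
  have X: "?X \<in> carrier unitization" by (rule to_unitization_simps)
  have vw: "?v \<in> carrier unitization" "?w \<in> carrier unitization"
    using X by (auto intro: U.finsum_closed)
  have "?v \<otimes>\<^bsub>unitization\<^esub> ?w = \<one>\<^bsub>unitization\<^esub>" "?w \<otimes>\<^bsub>unitization\<^esub> ?v = \<one>\<^bsub>unitization\<^esub>"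
    using x U.geometric_sum[OF X, of k] by (simp_all add: power_vanishes_def U.minus_eq)
  then have "?v \<in> Units unitization" "inv\<^bsub>unitization\<^esub> ?v = ?w"
    using vw U.inv_char by (auto simp: Units_def)
  moreover have "to_unitization (\<alpha> a) = ?v \<otimes>\<^bsub>unitization\<^esub> to_unitization a \<otimes>\<^bsub>unitization\<^esub> ?w" for a
    using nilpotent_conjugate_eq[of x k a] by (simp add: nilpotent_conjugate_def \<alpha>_def)
  ultimately have "inner_automorphism \<alpha>"
    unfolding inner_automorphism_def by (intro bexI[of _ ?v]) auto
  then have "\<alpha> a \<in> V"
    using inner a by (auto simp: invariant_under_def)
  then show ?thesis by (simp add: nilpotent_conjugate_eq \<alpha>_def)
qed

section \<open>Linear terms of conjugates over an infinite field\<close>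

lemma (in vector_space) subspace_polynomial_coeff:
  assumes V: "subspace V" and inf: "infinite (UNIV :: 'a set)"
    and "\<And>t. (\<Sum>i\<le>n. (t ^ i) *s b i) \<in> V" and "i \<le> n"
  shows "b i \<in> V"
  using assms(3,4)
proof (induction n arbitrary: b i)
  case 0
  then show ?case by simp
next
  case (Suc n)
  note sum = Suc.prems(1)
  have "finite {t :: 'a. t ^ j = t ^ Suc n}" if "j \<le> n" for j
  proof -
    let ?p = "monom 1 j - monom 1 (Suc n) :: 'a poly"
    have "coeff ?p j = 1" using that by simp
    then have "?p \<noteq> 0" by (metis coeff_0 zero_neq_one)
    then have "finite {t. poly ?p t = 0}" by (rule poly_roots_finite)
    then show ?thesis by (simp add: poly_monom)
  qed
  then have "finite (\<Union>j\<le>n. {t :: 'a. t ^ j = t ^ Suc n})" by blast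
  \<comment> \<open>For the polynomial \<open>f\<close> with coefficients \<open>b\<close>, the
    combination \<open>f (t s) - t^(n+1) f s\<close> has no top term, and this \<open>t\<close>
    keeps the factors \<open>t^i - t^(n+1)\<close> of the lower coefficients invertible.\<close>
  then obtain t :: 'a where "t \<notin> (\<Union>j\<le>n. {t. t ^ j = t ^ Suc n})"
    using inf ex_new_if_finite by blast
  then have t: "t ^ j - t ^ Suc n \<noteq> 0" if "j \<le> n" for j
    using that by auto
  have low: "b j \<in> V" if "j \<le> n" for j
  proof -
    have "(\<Sum>i\<le>n. (s ^ i) *s ((t ^ i - t ^ Suc n) *s b i)) \<in> V" for s
    proof -
      have "(\<Sum>i\<le>n. (s ^ i) *s ((t ^ i - t ^ Suc n) *s b i)) =
          (\<Sum>i\<le>Suc n. ((t * s) ^ i) *s b i) - t ^ Suc n *s (\<Sum>i\<le>Suc n. (s ^ i) *s b i)"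
        by (simp add: scale_sum_right scale_right_distrib sum_subtractf[symmetric] power_mult_distrib
            algebra_simps)
      then show ?thesis
        using subspace_diff[OF V sum subspace_scale[OF V sum]] by simp
    qed
    then have "(t ^ j - t ^ Suc n) *s b j \<in> V"
      using Suc.IH[of "\<lambda>i. (t ^ i - t ^ Suc n) *s b i"] that by blast
    then have "inverse (t ^ j - t ^ Suc n) *s ((t ^ j - t ^ Suc n) *s b j) \<in> V"
      by (rule subspace_scale[OF V])
    then show ?thesis using t[OF that] by simp
  qed
  have "b (Suc n) = (\<Sum>i\<le>Suc n. (1 ^ i) *s b i) - (\<Sum>i\<le>n. b i)" by simp
  also have "\<dots> \<in> V"
    using low by (intro subspace_diff[OF V] sum subspace_sum[OF V]) auto
  finally show ?case
    using low Suc.prems(2) by (cases "i = Suc n") auto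
qed

lemma (in rng_algebra) funpow_mult_scale:
  "((*) (scale t x) ^^ i) a = scale (t ^ i) (((*) x ^^ i) a)"
  "((*) x ^^ i) (scale t a) = scale t (((*) x ^^ i) a)"
  by (induction i) (simp_all add: scale_mult_left scale_mult_right)

lemma (in rng_algebra) nilpotent_conjugate_imp_commutator:
  assumes inf: "infinite (UNIV :: 'k set)" and V: "subspace V"
    and conj: "\<And>a x k. \<lbrakk>a \<in> V; k \<ge> 1; power_vanishes x k\<rbrakk> \<Longrightarrow> nilpotent_conjugate x k a \<in> to_unitization ` V"
    and x: "nilpotent x" and a: "a \<in> V"
  shows "\<langle>x, a\<rangle> \<in> V"
proof -
  let ?L = "\<lambda>i. ((*) x ^^ i) a"
  obtain k where "k \<ge> 1" "power_vanishes x k"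
    using x by (auto simp: nilpotent_def)
  then obtain j where j: "((*) x ^^ j) x = 0"
    using power_vanishes_Suc[of x "k - 1"] by auto
  \<comment> \<open>The power \<open>x^(j+1)\<close> already vanishes; one more ensures
    \<open>n\<close> is at least 2, so that the linear coefficient \<open>b 1\<close> contains
    \<open>x a\<close>.\<close>
  define n where "n = Suc (Suc j)"
  have vanish: "power_vanishes (scale t x) n" for t
    using j by (simp add: n_def power_vanishes_Suc funpow_mult_scale)
  \<comment> \<open>The coefficient of \<open>t^i\<close> in
    \<open>(1 + t x + ... + (t x)^(n-1)) a (1 - t x)\<close>.\<close>
  define b where "b i = (if i < n then ?L i else 0) - (if i = 0 then 0 else ?L (i - 1) * x)" for i
  have "(\<Sum>i\<le>n. scale (t ^ i) (b i)) \<in> V" for t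
  proof -
    have "(\<Sum>i\<le>n. scale (t ^ i) (if i < n then ?L i else 0)) = (\<Sum>i<n. scale (t ^ i) (?L i))"
      by (simp flip: lessThan_Suc_atMost)
    moreover have "(\<Sum>i\<le>n. scale (t ^ i) (if i = 0 then 0 else ?L (i - 1) * x)) =
        (\<Sum>i<n. scale (t ^ Suc i) (?L i * x))"
      unfolding n_def sum.atMost_Suc_shift lessThan_Suc_atMost by simp
    ultimately have "(\<Sum>i\<le>n. scale (t ^ i) (b i)) =
        (\<Sum>i<n. ((*) (scale t x) ^^ i) a - ((*) (scale t x) ^^ i) a * scale t x)"
      by (simp add: b_def scale_right_diff_distrib sum_subtractf funpow_mult_scale scale_mult_left
          scale_mult_right mult.commute)
    moreover have "nilpotent_conjugate (scale t x) n a \<in> to_unitization ` V"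
      using conj[OF a _ vanish] by (simp add: n_def)
    ultimately show ?thesis
      by (auto simp: nilpotent_conjugate_eq to_unitization_simps)
  qed
  then have "b 1 \<in> V"
    by (rule subspace_polynomial_coeff[OF V inf]) (simp add: n_def)
  then show ?thesis by (simp add: b_def n_def commutator_def)
qed

theorem theorem5p5:
  fixes scale :: "'k::field \<Rightarrow> 'a::ring \<Rightarrow> 'a"
    and V :: "'a set"
  assumes "rng_algebra scale"
    and "infinite (UNIV :: 'k set)"
    and "\<forall>x y :: 'a. sum_of_nilpotents (commutator x y)"
    and "\<forall>I :: 'a set. two_sided_ideal I \<and> I \<noteq> UNIV \<longrightarrow>
           (\<exists>P. nonexceptional_prime_ideal P \<and> I \<subseteq> P)"
    and "Modules.module.subspace scale V"
    and "fully_noncentral V"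
  shows "((\<forall>\<alpha>. inner_automorphism \<alpha> \<longrightarrow> invariant_under V \<alpha>) \<longleftrightarrow>
          (\<forall>a\<in>V. \<forall>x. \<forall>k\<ge>1. power_vanishes x k \<longrightarrow> nilpotent_conjugate x k a \<in> to_unitization ` V)) \<and>
         ((\<forall>a\<in>V. \<forall>x. \<forall>k\<ge>1. power_vanishes x k \<longrightarrow> nilpotent_conjugate x k a \<in> to_unitization ` V) \<longleftrightarrow>
          commutator_span UNIV UNIV \<subseteq> V) \<and>
         (commutator_span UNIV UNIV \<subseteq> V \<longleftrightarrow> lie_ideal V) \<and>
         (lie_ideal V \<longleftrightarrow> derived_submodule V)"
    (is "(?inner \<longleftrightarrow> ?conj) \<and> (?conj \<longleftrightarrow> ?comm) \<and> (?comm \<longleftrightarrow> ?lie) \<and> (?lie \<longleftrightarrow> ?derived)")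
proof -
  interpret rng_algebra scale by fact
  have sub: "subspace V" by fact
  have V: "additive_subgroup_of V"
    using sub by (simp add: additive_subgroup_of_def subspace_0 subspace_diff)
  note span_iff = commutator_span_subset_iff[OF V]
  \<comment> \<open>The implications form the cycle (1), (2), (5), (3), (1), with (4) inserted
    between (3) and (5).\<close>
  have "?conj" if "?inner"
    using that inner_invariant_imp_nilpotent_conjugate[of V] by blast
  moreover have "?derived" if "?conj"
  proof -
    have nil: "\<langle>x, v\<rangle> \<in> V" if "nilpotent x" "v \<in> V" for x v
      using nilpotent_conjugate_imp_commutator[OF assms(2) sub _ that] \<open>?conj\<close> by blast
    have sums: "\<langle>sum_list ys, v\<rangle> \<in> V" if "\<forall>y\<in>set ys. nilpotent y" "v \<in> V" for ys v
      using that
      by (induction ys) (simp_all add: commutator_expand nil additive_subgroup_ofD[OF V])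
    have comm: "\<langle>\<langle>x, y\<rangle>, v\<rangle> \<in> V" if "v \<in> V" for x y v
    proof -
      obtain ys where "\<forall>y\<in>set ys. nilpotent y" "\<langle>x, y\<rangle> = sum_list ys"
        using assms(3) unfolding sum_of_nilpotents_def by blast
      then show ?thesis using sums that by simp
    qed
    have "\<langle>c, v\<rangle> \<in> V" if "c \<in> commutator_span UNIV UNIV" "v \<in> V" for c v
      using that(1) unfolding commutator_span_def
      by (induction rule: group_closure.induct)
        (use comm that(2) in \<open>auto simp: commutator_expand additive_subgroup_ofD[OF V]\<close>)
    then show ?thesis
      using V span_iff by (simp add: derived_submodule_def)
  qed
  moreover have "?comm" if "?derived"
    using commutators_subset_derived_submodule assms(4,6) that by blast
  moreover have "?inner" if "?comm"
    using that commutators_subset_imp_inner_invariant[OF V] by (simp add: span_iff)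
  moreover have "?lie" if "?comm"
    using that V by (simp add: lie_ideal_def span_iff)
  moreover have "?derived" if "?lie"
    using that by (simp add: lie_ideal_def derived_submodule_def span_iff)
  ultimately show ?thesis by blast
qed

end
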